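(* Let $X$ be the squarefree flow with left shift $\sigma$, let $G=\prod_p\mathbb{Z}/p^2\mathbb{Z}$ with mass-one Haar measure $m$, let $\omega_{(1/2,1/2)}$ be the $(1/2,1/2)$ Bernoulli measure on $\Omega^{(2)}$, let $T$ be the skew-product transformation on $G\times\Omega^{(2)}$, let $\iota:G\times\Omega^{(2)}\to X$ be the insertion map, and let $\eta=\iota_{*}(m\times\omega_{(1/2,1/2)})$. Then $\iota$ induces an isomorphism of measure-preserving systems $$\iota:(G\times\Omega^{(2)},T,m\times\omega_{(1/2,1/2)})\xrightarrow{\sim}(X,\sigma,\eta).$$
   Context: $\mathbb{N}=\{1,2,3,\dots\}$; $\Omega^{(2)}=\{0,1\}^{\mathbb{N}}$ with the product topology, and $\sigma$ is the left shift $(\sigma x)_n=x_{n+1}$. For $x\in\Omega^{(2)}$, $\operatorname{supp}(x)=\{n\in\mathbb{N}:x_n=1\}$. The squarefree flow $X\subset\Omega^{(2)}$ is the closed shift-invariant set of all $x$ such that for every prime $p$ the reduction of $\operatorname{supp}(x)$ modulo $p^2$ is a proper subset of $\mathbb{Z}/p^2\mathbb{Z}$. The product defining $G$ is over all primes $p$. Define $T_1:G\to G$ by $(T_1g)_p=g_p-1$ for every $p$, and $G_1=\{g\in G: g_p\equiv 1\bmod p^2\text{ for some prime }p\}$. The skew product $T:G\times\Omega^{(2)}\to G\times\Omega^{(2)}$ is $T(g,y)=(T_1g,y)$ if $g\in G_1$, and $T(g,y)=(T_1g,\sigma y)$ if $g\notin G_1$. The measure $\omega_{(1/2,1/2)}$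 is the product measure on $\{0,1\}^{\mathbb{N}}$ giving each symbol mass $1/2$ in each coordinate. For $g\in G$ and $k\in\mathbb{N}$ put $\alpha_g(k)=|\{1\le n\le k: n\equiv g_p\bmod p^2\text{ for some prime }p\}|$. The insertion map is $\iota(g,y)_k=0$ if $k\equiv g_p\bmod p^2$ for some prime $p$, and $\iota(g,y)_k=y_{k-\alpha_g(k)}$ otherwise. An isomorphism of measure-preserving systems is a measurable, measure-preserving, equivariant map that is a bijection, with measurable inverse, between measurable subsets of full measure. *)

theory Defs
  imports
    "HOL-Probability.Probability"
    "HOL-Algebra.Product_Groups"
    "HOL-Number_Theory.Cong"
begin

section \<open>Measure-preserving systems\<close>

definition mps :: "'a measure \<Rightarrow> ('a \<Rightarrow> 'a) \<Rightarrow> bool" where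
  "mps M T \<longleftrightarrow> prob_space M \<and> T \<in> M \<rightarrow>\<^sub>M M \<and> distr M M T = M"

text \<open>
  The map \<open>f\<close> is total and measurable between the two spaces; the sets \<open>A\<close> and \<open>B\<close> of full measure,
  between which it is bijective, are required to be forward invariant, so that equivariance makes
  sense for the restriction \<open>f : A \<rightarrow> B\<close>.
\<close>

definition mps_isomorphism ::
  "'a measure \<Rightarrow> ('a \<Rightarrow> 'a) \<Rightarrow> 'b measure \<Rightarrow> ('b \<Rightarrow> 'b) \<Rightarrow> ('a \<Rightarrow> 'b) \<Rightarrow> bool" where
  "mps_isomorphism M T N S f \<longleftrightarrow>
     mps M T \<and> mps N S \<and> f \<in> M \<rightarrow>\<^sub>M N \<and> distr M N f = N \<and>
     (\<exists>A\<in>sets M. \<exists>B\<in>sets N.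
        emeasure M (space M - A) = 0 \<and> emeasure N (space N - B) = 0 \<and>
        T ` A \<subseteq> A \<and> S ` B \<subseteq> B \<and>
        bij_betw f A B \<and>
        (\<forall>x\<in>A. f (T x) = S (f x)) \<and>
        inv_into A f \<in> restrict_space N B \<rightarrow>\<^sub>M restrict_space M A)"


section \<open>Sequences and the squarefree flow\<close>

text \<open>Sequences are indexed by the positive naturals and are \<open>undefined\<close> at index 0.\<close>

definition Omega2 :: "(nat \<Rightarrow> nat) set" where
  "Omega2 = {1..} \<rightarrow>\<^sub>E {0, 1}"

definition shift :: "(nat \<Rightarrow> nat) \<Rightarrow> nat \<Rightarrow> nat" where
  "shift x = (\<lambda>n\<in>{1..}. x (n + 1))"

definition supp :: "(nat \<Rightarrow> nat) \<Rightarrow> nat set" where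
  "supp x = {n\<in>{1..}. x n = 1}"

definition bernoulli_half :: "(nat \<Rightarrow> nat) measure" where
  "bernoulli_half = (\<Pi>\<^sub>M n\<in>{1..}. uniform_count_measure {0, 1})"

definition squarefree_flow :: "(nat \<Rightarrow> nat) set" where
  "squarefree_flow =
     {x \<in> Omega2. \<forall>p::nat. prime p \<longrightarrow>
        (\<lambda>n. int n mod int (p\<^sup>2)) ` supp x \<subset> carrier (integer_mod_group (p\<^sup>2))}"

text \<open>
  The Borel structure of the flow; on the product of countably many finite discrete spaces the
  Borel and the product sigma-algebra agree (see \<open>sets_PiM_eq_borel\<close> below).
\<close>

definition squarefree_space :: "(nat \<Rightarrow> nat) measure" where
  "squarefree_space =
     restrict_space (\<Pi>\<^sub>M n\<in>{1..}. count_space {0, 1}) squarefree_flow"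


section \<open>The group and its Haar measure\<close>

definition GG :: "(nat \<Rightarrow> int) monoid" where
  "GG = product_group {p. prime p} (\<lambda>p. integer_mod_group (p\<^sup>2))"

definition GG_top :: "(nat \<Rightarrow> int) topology" where
  "GG_top = product_topology (\<lambda>p. discrete_topology (carrier (integer_mod_group (p\<^sup>2)))) {p. prime p}"

text \<open>
  Mass-one left Haar measure on a compact group \<open>G\<close> with topology \<open>\<T>\<close>. No regularity clause is needed
  for metrizable groups, where every finite Borel measure is regular.
\<close>

definition normalized_haar_measure ::
  "('a, 'c) monoid_scheme \<Rightarrow> 'a topology \<Rightarrow> 'a measure \<Rightarrow> bool" where
  "normalized_haar_measure G \<T> m \<longleftrightarrow>
     space m = carrier G \<and>
     sets m = sigma_sets (carrier G) {U. openin \<T> U} \<and>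
     emeasure m (carrier G) = 1 \<and>
     (\<forall>g\<in>carrier G. \<forall>A\<in>sets m. emeasure m (g <#\<^bsub>G\<^esub> A) = emeasure m A)"


section \<open>Skew product and insertion map\<close>

definition T1 :: "(nat \<Rightarrow> int) \<Rightarrow> nat \<Rightarrow> int" where
  "T1 g = (\<lambda>p\<in>{p. prime p}. (g p - 1) mod int (p\<^sup>2))"

definition G1 :: "(nat \<Rightarrow> int) set" where
  "G1 = {g \<in> carrier GG. \<exists>p::nat. prime p \<and> [g p = 1] (mod int (p\<^sup>2))}"

definition skew :: "(nat \<Rightarrow> int) \<times> (nat \<Rightarrow> nat) \<Rightarrow> (nat \<Rightarrow> int) \<times> (nat \<Rightarrow> nat)" where
  "skew = (\<lambda>(g, y). (T1 g, if g \<in> G1 then y else shift y))"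

definition alpha :: "(nat \<Rightarrow> int) \<Rightarrow> nat \<Rightarrow> nat" where
  "alpha g k = card {n\<in>{1..k}. \<exists>p::nat. prime p \<and> [int n = g p] (mod int (p\<^sup>2))}"

definition insertion :: "(nat \<Rightarrow> int) \<times> (nat \<Rightarrow> nat) \<Rightarrow> nat \<Rightarrow> nat" where
  "insertion = (\<lambda>(g, y). \<lambda>k\<in>{1..}.
     if \<exists>p::nat. prime p \<and> [int k = g p] (mod int (p\<^sup>2)) then 0 else y (k - alpha g k))"

definition eta :: "(nat \<Rightarrow> int) measure \<Rightarrow> (nat \<Rightarrow> nat) measure" where
  "eta m = distr (m \<Otimes>\<^sub>M bernoulli_half) squarefree_space insertion"


section \<open>Existence of the Haar measure\<close>

lemma sets_PiM_eq_borel: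
  fixes A :: "'i \<Rightarrow> 'a set"
  assumes I: "countable I" and fin: "\<And>i. i \<in> I \<Longrightarrow> finite (A i)"
  shows "sets (\<Pi>\<^sub>M i\<in>I. count_space (A i)) =
    sigma_sets (\<Pi>\<^sub>E i\<in>I. A i) {U. openin (product_topology (\<lambda>i. discrete_topology (A i)) I) U}"
    (is "sets ?M = sigma_sets ?S ?O")
proof
  let ?N = "sigma ?S ?O"
  have O: "?O \<subseteq> Pow ?S" using openin_subset by fastforce
  have "sets ?M \<subseteq> sets ?N"
  proof (rule sets_PiM_in_sets)
    show "space ?N = (\<Pi>\<^sub>E i\<in>I. space (count_space (A i)))"
      using O by simp
  next
    fix i X assume i: "i \<in> I" and X: "X \<in> sets (count_space (A i))"
    have "openin (product_topology (\<lambda>i. discrete_topology (A i)) I)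
            {x \<in> topspace (product_topology (\<lambda>i. discrete_topology (A i)) I). x i \<in> X}"
      using i X by (intro openin_continuous_map_preimage[OF continuous_map_product_projection]) auto
    then show "{x \<in> space ?N. x i \<in> X} \<in> sets ?N"
      using O by (simp add: sigma_sets.Basic)
  qed
  then show "sets ?M \<subseteq> sigma_sets ?S ?O" using O by simp
next
  define cyl where "cyl = (\<lambda>(F, a). {y \<in> ?S. \<forall>i\<in>F. y i = (a i :: 'a)})"
  define J where "J = (SIGMA F:{F. finite F \<and> F \<subseteq> I}. \<Pi>\<^sub>E i\<in>F. A i)"
  have cJ: "countable J"
    unfolding J_def using I fin
    by (intro countable_SIGMA countable_Collect_finite_subset countable_PiE)
       (auto intro: countable_finite)
  have mcyl: "cyl j \<in> sets ?M" if "j \<in> J" for j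
  proof -
    obtain F a where j: "j = (F, a)" by (cases j)
    have F: "finite F" "F \<subseteq> I" and a: "a \<in> (\<Pi>\<^sub>E i\<in>F. A i)" using that by (auto simp: J_def j)
    have "cyl j = prod_emb I (\<lambda>i. count_space (A i)) F (\<Pi>\<^sub>E i\<in>F. {a i})"
    proof -
      have "restrict x F \<in> (\<Pi>\<^sub>E i\<in>F. {a i}) \<longleftrightarrow> (\<forall>i\<in>F. x i = a i)" for x
        by (auto simp: PiE_iff)
      then show ?thesis by (simp add: cyl_def j prod_emb_def set_eq_iff conj_commute)
    qed
    also have "\<dots> \<in> sets ?M" using F a by (intro sets_PiM_I) (auto simp: PiE_iff)
    finally show ?thesis .
  qed
  show "sigma_sets ?S ?O \<subseteq> sets ?M"
  proof -
    have "?O \<subseteq> sets ?M"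
    proof safe
      fix U assume U: "openin (product_topology (\<lambda>i. discrete_topology (A i)) I) U"
      have "U = (\<Union>j\<in>{j\<in>J. cyl j \<subseteq> U}. cyl j)"
      proof (intro equalityI subsetI)
        fix x assume x: "x \<in> U"
        with U have "\<exists>X. finite {i \<in> I. X i \<noteq> A i} \<and> x \<in> PiE I X \<and> PiE I X \<subseteq> U"
          by (auto simp: openin_product_topology_alt)
        then obtain X where X: "finite {i \<in> I. X i \<noteq> A i}" "x \<in> PiE I X" "PiE I X \<subseteq> U"
          by blast
        have xS: "x \<in> ?S" using x openin_subset[OF U] by auto
        define F where "F = {i \<in> I. X i \<noteq> A i}"
        have "(F, restrict x F) \<in> J" using X(1) xS by (auto simp: J_def F_def PiE_iff)
        moreover have "cyl (F, restrict x F) \<subseteq> PiE I X"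
        proof
          fix y assume y: "y \<in> cyl (F, restrict x F)"
          then have yS: "y \<in> ?S" and yx: "\<And>i. i \<in> F \<Longrightarrow> y i = x i" by (auto simp: cyl_def)
          have "y i \<in> X i" if "i \<in> I" for i
            using that yx[of i] PiE_mem[OF X(2) that] PiE_mem[OF yS that]
            by (cases "i \<in> F") (simp_all add: F_def)
          then show "y \<in> PiE I X" using yS by (simp add: PiE_iff)
        qed
        moreover have "x \<in> cyl (F, restrict x F)" using xS by (auto simp: cyl_def)
        ultimately show "x \<in> (\<Union>j\<in>{j\<in>J. cyl j \<subseteq> U}. cyl j)" using X(3) by blast
      qed auto
      also have "\<dots> \<in> sets ?M"
        using cJ mcyl by (intro sets.countable_UN') auto
      finally show "U \<in> sets ?M" .
    qed
    then show ?thesis using sets.sigma_sets_subset[of ?O ?M] by (simp add: space_PiM)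
  qed
qed

lemma normalized_haar_measure_GG:
  "normalized_haar_measure GG GG_top
     (\<Pi>\<^sub>M p\<in>{p. prime p}. uniform_count_measure (carrier (integer_mod_group (p\<^sup>2))))"
proof -
  define P where "P = {p::nat. prime p}"
  define A where "A = (\<lambda>p::nat. carrier (integer_mod_group (p\<^sup>2)))"
  define N where "N = (\<lambda>p. if p \<in> P then uniform_count_measure (A p) else return (count_space UNIV) 0)"
  define M where "M = PiM P N"
  have A: "A p = {0..<int (p\<^sup>2)}" "finite (A p)" "A p \<noteq> {}" if "p \<in> P" for p
    using that prime_gt_0_nat[of p] by (auto simp: A_def P_def carrier_integer_mod_group)
  have N: "N p = uniform_count_measure (A p)" if "p \<in> P" for p using that by (simp add: N_def)
  have pN: "prob_space (N p)" for p
    using A[of p] by (auto simp: N_def intro!: prob_space_uniform_count_measure prob_space_return)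
  interpret product_prob_space N P
    by (intro product_prob_spaceI pN)
  have M_eq: "M = (\<Pi>\<^sub>M p\<in>{p. prime p}. uniform_count_measure (carrier (integer_mod_group (p\<^sup>2))))"
    unfolding M_def P_def[symmetric] A_def[symmetric] by (intro PiM_cong refl) (simp add: N A_def)
  have carr: "carrier GG = PiE P A" by (simp add: GG_def P_def A_def)
  have top: "GG_top = product_topology (\<lambda>p. discrete_topology (A p)) P"
    by (simp add: GG_top_def P_def A_def)
  have spN: "space (N p) = A p" "sets (N p) = Pow (A p)" if "p \<in> P" for p
    using that by (auto simp: N space_uniform_count_measure sets_uniform_count_measure)
  have sp: "space M = PiE P A" by (auto simp: M_def space_PiM spN intro!: PiE_cong)
  have "sets M = sets (\<Pi>\<^sub>M p\<in>P. count_space (A p))"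
    unfolding M_def by (intro sets_PiM_cong) (auto simp: spN)
  also have "\<dots> = sigma_sets (PiE P A) {U. openin GG_top U}"
    unfolding top by (intro sets_PiM_eq_borel) (auto simp: A)
  finally have sM: "sets M = sigma_sets (PiE P A) {U. openin GG_top U}" .
  have one: "emeasure M (PiE P A) = 1"
    using emeasure_space_1 sp by (simp add: M_def)
  have tr: "emeasure M (g <#\<^bsub>GG\<^esub> B) = emeasure M B" if g: "g \<in> PiE P A" and B: "B \<in> sets M" for g B
  proof -
    define f where "f = (\<lambda>h. \<lambda>p\<in>P. (h p - g p) mod int (p\<^sup>2))"
    have modA: "x mod int (p\<^sup>2) \<in> A p" if "p \<in> P" for p x
      using that prime_gt_0_nat[of p] by (auto simp: A P_def)
    have modid: "x mod int (p\<^sup>2) = x" if "p \<in> P" "x \<in> A p" for p x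
      using that by (auto simp: A)
    have ax: "(\<lambda>x. (x - c) mod int (p\<^sup>2)) \<in> N p \<rightarrow>\<^sub>M N p" if "p \<in> P" for p c
      by (rule measurableI) (use that modA in \<open>auto simp: spN\<close>)
    have fm: "f \<in> M \<rightarrow>\<^sub>M M"
      unfolding f_def M_def
    proof (intro measurable_restrict)
      fix p assume p: "p \<in> P"
      show "(\<lambda>h. (h p - g p) mod int (p\<^sup>2)) \<in> PiM P N \<rightarrow>\<^sub>M N p"
        by (rule measurable_compose[OF _ ax[OF p]]) (rule measurable_component_singleton[OF p])
    qed
    have d: "distr M M f = M"
    proof -
      have "PiM P N = distr M M f"
      proof (rule measure_eqI_PiM_infinite)
        show "sets (PiM P N) = sets (PiM P N)" "sets (distr M M f) = sets (PiM P N)"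
          by (simp_all add: M_def)
        show "finite_measure (PiM P N)" by unfold_locales
      next
        fix X J assume J: "finite J" "J \<subseteq> P" and X: "\<And>i. i \<in> J \<Longrightarrow> X i \<in> sets (N i)"
        define Y where "Y = (\<lambda>p. {x \<in> A p. (x - g p) mod int (p\<^sup>2) \<in> X p})"
        have Y: "Y p \<in> sets (N p)" if "p \<in> J" for p using that J spN by (auto simp: Y_def)
        have "emeasure (distr M M f) (prod_emb P N J (Pi\<^sub>E J X))
            = emeasure M (f -` prod_emb P N J (Pi\<^sub>E J X) \<inter> space M)"
          using J X fm by (intro emeasure_distr) (auto simp: M_def intro!: sets_PiM_I)
        also have "f -` prod_emb P N J (Pi\<^sub>E J X) \<inter> space M = prod_emb P N J (Pi\<^sub>E J Y)"
          using J X modA by (fastforce simp: prod_emb_def sp f_def Y_def PiE_iff spN extensional_def)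
        also have "emeasure M \<dots> = (\<Prod>p\<in>J. emeasure (N p) (Y p))"
          unfolding M_def using J Y by (intro emeasure_PiM_emb) auto
        also have "\<dots> = (\<Prod>p\<in>J. emeasure (N p) (X p))"
        proof (intro prod.cong refl)
          fix p assume p: "p \<in> J"
          then have pP: "p \<in> P" using J by auto
          have YA: "Y p \<subseteq> A p" by (auto simp: Y_def)
          have XA: "X p \<subseteq> A p" using X[OF p] spN[OF pP] by auto
          have "bij_betw (\<lambda>x. (x - g p) mod int (p\<^sup>2)) (Y p) (X p)"
          proof (rule bij_betw_byWitness[where f' = "\<lambda>x. (x + g p) mod int (p\<^sup>2)"])
            show "\<forall>x\<in>Y p. ((x - g p) mod int (p\<^sup>2) + g p) mod int (p\<^sup>2) = x"
              using modid[OF pP] by (auto simp: Y_def mod_simps)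
            show "\<forall>x\<in>X p. ((x + g p) mod int (p\<^sup>2) - g p) mod int (p\<^sup>2) = x"
              using modid[OF pP] XA by (auto simp: mod_simps)
            then show "(\<lambda>x. (x + g p) mod int (p\<^sup>2)) ` X p \<subseteq> Y p"
              using modA[OF pP] by (auto simp: Y_def)
          qed (auto simp: Y_def)
          then have "card (Y p) = card (X p)" by (rule bij_betw_same_card)
          then show "emeasure (N p) (Y p) = emeasure (N p) (X p)"
            using XA YA A(2)[OF pP] by (simp add: N[OF pP] emeasure_uniform_count_measure)
        qed
        also have "\<dots> = emeasure (PiM P N) (prod_emb P N J (Pi\<^sub>E J X))"
          using J X by (intro emeasure_PiM_emb[symmetric]) auto
        finally show "emeasure (PiM P N) (prod_emb P N J (Pi\<^sub>E J X)) =
          emeasure (distr M M f) (prod_emb P N J (Pi\<^sub>E J X))" ..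
      qed
      then show ?thesis by (simp add: M_def)
    qed
    have BS: "B \<subseteq> PiE P A" using sets.sets_into_space[OF B] sp by simp
    have mult: "g \<otimes>\<^bsub>GG\<^esub> h = (\<lambda>p\<in>P. (g p + h p) mod int (p\<^sup>2))" for h
      by (simp add: GG_def P_def)
    have "g <#\<^bsub>GG\<^esub> B = f -` B \<inter> space M"
    proof (intro equalityI subsetI)
      fix x assume "x \<in> g <#\<^bsub>GG\<^esub> B"
      then obtain h where h: "h \<in> B" "x = (\<lambda>p\<in>P. (g p + h p) mod int (p\<^sup>2))"
        by (auto simp: l_coset_def mult)
      have hS: "h \<in> PiE P A" using h BS by auto
      have "f x = h"
      proof
        fix p show "f x p = h p"
          using PiE_mem[OF hS, of p] PiE_arb[OF hS, of p] modid[of p "h p"]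
          by (cases "p \<in> P") (simp_all add: f_def h(2) mod_simps)
      qed
      moreover have "x \<in> PiE P A" unfolding h(2) using modA by (intro restrict_PiE_iff[THEN iffD2]) auto
      ultimately show "x \<in> f -` B \<inter> space M" using h by (simp add: sp)
    next
      fix x assume x: "x \<in> f -` B \<inter> space M"
      then have xS: "x \<in> PiE P A" by (simp add: sp)
      have "x = g \<otimes>\<^bsub>GG\<^esub> f x"
      proof
        fix p show "x p = (g \<otimes>\<^bsub>GG\<^esub> f x) p"
          using PiE_mem[OF xS, of p] PiE_arb[OF xS, of p] modid[of p "x p"]
          by (cases "p \<in> P") (simp_all add: f_def mult mod_simps)
      qed
      then show "x \<in> g <#\<^bsub>GG\<^esub> B" using x by (auto simp: l_coset_def)
    qed
    then have "emeasure M (g <#\<^bsub>GG\<^esub> B) = emeasure (distr M M f) B"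
      using emeasure_distr[OF fm B] by simp
    then show ?thesis by (simp add: d)
  qed
  show ?thesis
    unfolding M_eq[symmetric] normalized_haar_measure_def carr
    using sp sM one tr by auto
qed

end

theory Submission
  imports Defs
begin

text \<open>
  A point \<open>g\<close> of the group forbids, for each prime \<open>p\<close>, the residue class of \<open>g p\<close> modulo \<open>p\<^sup>2\<close>.
  The insertion map writes \<open>0\<close> at all forbidden (sieved) positions and copies \<open>y\<close>, in order, into the
  remaining ones. It intertwines the skew product with the shift at every point: moving the window by
  one step replaces \<open>g\<close> by \<^term>\<open>T1 g\<close>, and it consumes a symbol of \<open>y\<close> exactly when position \<open>1\<close> is not
  sieved (\<open>insertion_skew\<close>).

  To invert the map, observe that the support of \<open>insertion (g, y)\<close> misses the class of \<open>g p\<close> modulo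
  \<open>p\<^sup>2\<close>. If it meets every other class infinitely often (\<open>full_off\<close>), then \<open>g\<close> is read off as the
  family of missed classes. Moreover infinitely many positions are then unsieved, so every symbol of
  \<open>y\<close> appears in the sequence, and \<open>y\<close> is read off at the unsieved positions. Asking for infinitely
  many hits rather than one makes the set of such points invariant under the dynamics. Every map
  involved depends on coordinates through countable logical combinations, hence is measurable.

  It remains to see that almost every \<open>(g, y)\<close> is of this kind. Fix a prime \<open>p\<close> and a class \<open>r\<close> other
  than \<open>g p\<close>. For each \<open>Q\<close>, the Chinese remainder theorem supplies positions in the class \<open>r\<close> that no
  prime up to \<open>Q\<close> sieves; the first such position beyond \<open>K\<close> depends only on the coordinates up to \<open>Q\<close>.
  Hence for a prime \<open>q > Q\<close>, translating the coordinate \<open>q\<close> shows that \<open>q\<close> sieves this position with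
  probability exactly \<open>1 / q\<^sup>2\<close> (\<open>haar_coordinate\<close>). So the probability that all positions beyond
  \<open>K\<close> in the class \<open>r\<close> are sieved is at most the tail of \<open>\<Sum>q. 1 / q\<^sup>2\<close> beyond \<open>Q\<close>, which tends to \<open>0\<close>
  (\<open>AE_unsieved_in_class\<close>). Thus almost surely the class \<open>r\<close> contains infinitely many unsieved
  positions; they are filled with distinct fair coin tosses, one of which almost surely shows \<open>1\<close>, and
  Fubini's theorem concludes (\<open>AE_full_off\<close>).
\<close>

section \<open>Sieved positions and the slots between them\<close>

definition sieved :: "(nat \<Rightarrow> int) \<Rightarrow> nat set" where
  "sieved g = {n. \<exists>p::nat. prime p \<and> [int n = g p] (mod int (p\<^sup>2))}"

definition slot :: "(nat \<Rightarrow> int) \<Rightarrow> nat \<Rightarrow> nat" where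
  "slot g k = card ({1..k} - sieved g)"

lemma GG_carrier: "carrier GG = (\<Pi>\<^sub>E p\<in>{p. prime p}. {0..<int (p\<^sup>2)})"
  unfolding GG_def carrier_product_group
  by (intro PiE_cong) (simp add: carrier_integer_mod_group)

lemma diff_alpha: "k - alpha g k = slot g k"
proof -
  have "alpha g k = card ({1..k} \<inter> sieved g)"
    unfolding alpha_def by (intro arg_cong[of _ _ card]) (auto simp: sieved_def)
  then show ?thesis
    by (simp add: slot_def card_Diff_subset_Int)
qed

lemma insertion_apply:
  assumes "1 \<le> k"
  shows "insertion (g, y) k = (if k \<in> sieved g then 0 else y (slot g k))"
  using assms by (auto simp: insertion_def diff_alpha sieved_def)

lemma slot_less:
  assumes "j < k" "k \<notin> sieved g"
  shows "slot g j < slot g k"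
proof -
  have "k \<in> {1..k} - sieved g" "k \<notin> {1..j} - sieved g" using assms by auto
  moreover have "{1..j} - sieved g \<subseteq> {1..k} - sieved g" using assms by auto
  ultimately have "{1..j} - sieved g \<subset> {1..k} - sieved g" by blast
  then show ?thesis unfolding slot_def by (intro psubset_card_mono) auto
qed

lemma slot_pos: "1 \<le> k \<Longrightarrow> k \<notin> sieved g \<Longrightarrow> 1 \<le> slot g k"
  using slot_less[of 0 k g] by linarith

lemma slot_inj:
  assumes "j \<notin> sieved g" "k \<notin> sieved g" "slot g j = slot g k"
  shows "j = k"
  using slot_less[of j k g] slot_less[of k j g] assms by (metis less_irrefl linorder_neqE_nat)

lemma slot_surj:
  assumes inf: "infinite (- sieved g)"
  shows "\<exists>k. slot g k = n \<and> (1 \<le> n \<longrightarrow> 1 \<le> k \<and> k \<notin> sieved g)"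
proof (induction n)
  case 0
  show ?case by (rule exI[of _ 0]) (simp add: slot_def)
next
  case (Suc n)
  then obtain j where j: "slot g j = n" by auto
  define k where "k = (LEAST k. j < k \<and> k \<notin> sieved g)"
  have "\<exists>k. j < k \<and> k \<notin> sieved g"
    using inf by (auto simp: infinite_nat_iff_unbounded)
  then have k: "j < k" "k \<notin> sieved g" unfolding k_def by (metis (mono_tags, lifting) LeastI)+
  have "\<And>i. i < k \<Longrightarrow> i \<notin> sieved g \<Longrightarrow> i \<le> j"
    unfolding k_def using not_less_Least not_le by blast
  then have "i \<in> {1..k} - sieved g \<longleftrightarrow> i \<in> insert k ({1..j} - sieved g)" for i
    using k by (cases i k rule: linorder_cases) (auto simp: not_le)
  then have "{1..k} - sieved g = insert k ({1..j} - sieved g)" by blast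
  then have "slot g k = Suc n"
    using k j by (simp add: slot_def)
  then show ?case using k by (intro exI[of _ k]) auto
qed

text \<open>
  The inverse of \<^const>\<open>slot\<close>: the position of the \<open>n\<close>-th integer surviving the sieve. The least-element
  form is chosen because it is visibly measurable in \<open>g\<close>.
\<close>

definition survivor :: "(nat \<Rightarrow> int) \<Rightarrow> nat \<Rightarrow> nat" where
  "survivor g n = (LEAST k. 1 \<le> k \<and> k \<notin> sieved g \<and> slot g k = n)"

lemma survivor_slot:
  assumes "1 \<le> k" "k \<notin> sieved g"
  shows "survivor g (slot g k) = k"
  unfolding survivor_def using assms by (intro Least_equality) (auto dest: slot_inj)

lemma survivor:
  assumes "infinite (- sieved g)" "1 \<le> n"
  shows "1 \<le> survivor g n" "survivor g n \<notin> sieved g" "slot g (survivor g n) = n"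
proof -
  have "\<exists>k. 1 \<le> k \<and> k \<notin> sieved g \<and> slot g k = n"
    using slot_surj[OF assms(1), of n] assms(2) by auto
  from LeastI_ex[OF this, folded survivor_def]
  show "1 \<le> survivor g n" "survivor g n \<notin> sieved g" "slot g (survivor g n) = n" by auto
qed


section \<open>Reading the group element off a sequence\<close>

text \<open>
  One hit in each class other than that of \<open>g p\<close> would identify \<open>g\<close>. Infinitely many hits make the
  condition survive the shift and leave infinitely many unsieved positions.
\<close>

definition full_off :: "(nat \<Rightarrow> int) \<Rightarrow> (nat \<Rightarrow> nat) \<Rightarrow> bool" where
  "full_off g x \<longleftrightarrow> (\<forall>p::nat. prime p \<longrightarrow> (\<forall>r\<in>{0..<int (p\<^sup>2)}. r \<noteq> g p \<longrightarrow>
     (\<forall>K. \<exists>k>K. x k = 1 \<and> [int k = r] (mod int (p\<^sup>2)))))"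

definition missed :: "(nat \<Rightarrow> nat) \<Rightarrow> nat \<Rightarrow> int" where
  "missed x = (\<lambda>p\<in>{p. prime p}. int (LEAST c. \<forall>k\<in>supp x. \<not> [int k = int c] (mod int (p\<^sup>2))))"

definition recover :: "(nat \<Rightarrow> nat) \<Rightarrow> (nat \<Rightarrow> int) \<times> (nat \<Rightarrow> nat)" where
  "recover x = (missed x, \<lambda>n\<in>{1..}. x (survivor (missed x) n))"

lemma missed:
  assumes "x \<in> squarefree_flow"
  shows "missed x \<in> carrier GG" "supp x \<inter> sieved (missed x) = {}"
proof -
  have *: "missed x p \<in> {0..<int (p\<^sup>2)} \<and> (\<forall>k\<in>supp x. \<not> [int k = missed x p] (mod int (p\<^sup>2)))"
    if p: "prime p" for p :: nat
  proof -
    have p0: "p > 0" using p prime_gt_0_nat by auto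
    have "(\<lambda>n. int n mod int (p\<^sup>2)) ` supp x \<subset> {0..<int (p\<^sup>2)}"
      using assms p p0 by (simp add: squarefree_flow_def carrier_integer_mod_group)
    then obtain c where c: "c \<in> {0..<int (p\<^sup>2)}" "c \<notin> (\<lambda>n. int n mod int (p\<^sup>2)) ` supp x"
      by blast
    let ?P = "\<lambda>c::nat. \<forall>k\<in>supp x. \<not> [int k = int c] (mod int (p\<^sup>2))"
    have P: "?P (nat c)" using c by (auto simp: cong_def image_iff)
    have "missed x p = int (Least ?P)" using p by (simp add: missed_def)
    moreover have "?P (Least ?P)" by (rule LeastI[where P = ?P, OF P])
    moreover have "Least ?P \<le> nat c" by (rule Least_le[where P = ?P, OF P])
    ultimately show ?thesis using c(1) by (auto simp del: of_nat_power)
  qed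
  show "missed x \<in> carrier GG"
    unfolding GG_carrier using * by (auto simp: PiE_iff extensional_def missed_def)
  show "supp x \<inter> sieved (missed x) = {}" using * by (auto simp: sieved_def)
qed

text \<open>
  A sequence lies in the flow as soon as one \<open>g\<close> lists a missed class for every prime; by the preceding
  lemma \<^const>\<open>missed\<close> provides such a \<open>g\<close> for any sequence of the flow.
\<close>

lemma squarefree_flowI:
  assumes x: "x \<in> Omega2" and g: "g \<in> carrier GG" and disj: "supp x \<inter> sieved g = {}"
  shows "x \<in> squarefree_flow"
  unfolding squarefree_flow_def
proof (intro CollectI conjI allI impI x)
  fix p :: nat assume p: "prime p"
  then have p0: "p > 0" using prime_gt_0_nat by auto
  have gp: "g p \<in> {0..<int (p\<^sup>2)}" using g p by (auto simp: GG_carrier PiE_iff)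
  have "g p \<notin> (\<lambda>n. int n mod int (p\<^sup>2)) ` supp x"
  proof
    assume "g p \<in> (\<lambda>n. int n mod int (p\<^sup>2)) ` supp x"
    then obtain n where n: "n \<in> supp x" "g p = int n mod int (p\<^sup>2)" by blast
    then have "n \<in> sieved g" using p by (auto simp: sieved_def cong_def intro!: exI[of _ p])
    then show False using n disj by auto
  qed
  moreover have "(\<lambda>n. int n mod int (p\<^sup>2)) ` supp x \<subseteq> {0..<int (p\<^sup>2)}"
    using p0 by auto
  ultimately show "(\<lambda>n. int n mod int (p\<^sup>2)) ` supp x \<subset> carrier (integer_mod_group (p\<^sup>2))"
    using gp p0 by (auto simp: carrier_integer_mod_group)
qed

text \<open>
  The missed class of each prime is the only one, since all the others are hit; so the least missed
  class, which is what \<^const>\<open>missed\<close> selects, must be that of \<open>g\<close>.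
\<close>

lemma missed_unique:
  assumes g: "g \<in> carrier GG" and disj: "supp x \<inter> sieved g = {}" and full: "full_off g x"
  shows "missed x = g"
proof
  fix p
  show "missed x p = g p"
  proof (cases "prime p")
    case False
    then show ?thesis using g by (auto simp: GG_carrier missed_def PiE_iff extensional_def)
  next
    case True
    have gp: "g p \<in> {0..<int (p\<^sup>2)}" using g True by (auto simp: GG_carrier PiE_iff)
    have "(LEAST c. \<forall>k\<in>supp x. \<not> [int k = int c] (mod int (p\<^sup>2))) = nat (g p)"
    proof (rule Least_equality)
      show "\<forall>k\<in>supp x. \<not> [int k = int (nat (g p))] (mod int (p\<^sup>2))"
        using disj gp True by (auto simp: sieved_def)
    next
      fix c assume c: "\<forall>k\<in>supp x. \<not> [int k = int c] (mod int (p\<^sup>2))"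
      show "nat (g p) \<le> c"
      proof (rule ccontr)
        assume "\<not> nat (g p) \<le> c"
        then have "int c \<in> {0..<int (p\<^sup>2)}" "int c \<noteq> g p" using gp by (auto simp del: of_nat_power)
        then obtain k where "k > 0" "x k = 1" "[int k = int c] (mod int (p\<^sup>2))"
          using full True unfolding full_off_def by blast
        then show False using c by (auto simp: supp_def)
      qed
    qed
    then show ?thesis using gp True by (simp add: missed_def)
  qed
qed

text \<open>
  The prime \<open>2\<close> suffices: some class modulo \<open>4\<close> is not that of \<open>g 2\<close>, and it already contains
  infinitely many points of the support, none of them sieved.
\<close>

lemma infinite_unsieved:
  assumes disj: "supp x \<inter> sieved g = {}" and full: "full_off g x"
  shows "infinite (- sieved g)"
proof -
  define r :: int where "r = (if g 2 = 0 then 1 else 0)"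
  have "r \<in> {0..<int (2\<^sup>2)}" "r \<noteq> g 2" by (auto simp: r_def)
  with full two_is_prime_nat have "\<forall>K. \<exists>k>K. x k = 1 \<and> [int k = r] (mod int (2\<^sup>2))"
    unfolding full_off_def by blast
  moreover have "k \<in> - sieved g" if "k > K" "x k = 1" for k K
  proof -
    have "k \<in> supp x" using that by (simp add: supp_def)
    then show ?thesis using disj by auto
  qed
  ultimately have "\<forall>K. \<exists>k>K. k \<in> - sieved g" by blast
  then show ?thesis by (simp add: infinite_nat_iff_unbounded)
qed

lemma supp_insertion: "supp (insertion (g, y)) \<inter> sieved g = {}"
  by (auto simp: supp_def insertion_apply)

lemma insertion_in_Omega2:
  assumes "y \<in> Omega2"
  shows "insertion (g, y) \<in> Omega2"
proof -
  have "insertion (g, y) k \<in> {0, 1}" if "1 \<le> k" for k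
    using that slot_pos[of k g] assms PiE_mem[of y "{1..}" "\<lambda>_. {0, 1}" "slot g k"]
    by (auto simp: insertion_apply Omega2_def)
  then show ?thesis
    by (auto simp: Omega2_def PiE_iff extensional_def) (simp add: insertion_def)
qed

lemma insertion_in_flow:
  "g \<in> carrier GG \<Longrightarrow> y \<in> Omega2 \<Longrightarrow> insertion (g, y) \<in> squarefree_flow"
  using squarefree_flowI[OF insertion_in_Omega2 _ supp_insertion] by blast

lemma recover_insertion:
  assumes g: "g \<in> carrier GG" and y: "y \<in> Omega2" and full: "full_off g (insertion (g, y))"
  shows "recover (insertion (g, y)) = (g, y)"
proof -
  have m: "missed (insertion (g, y)) = g"
    by (rule missed_unique[OF g supp_insertion full])
  have inf: "infinite (- sieved g)" by (rule infinite_unsieved[OF supp_insertion full])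
  have "(\<lambda>n\<in>{1..}. insertion (g, y) (survivor g n)) = y"
  proof
    fix n show "(\<lambda>n\<in>{1..}. insertion (g, y) (survivor g n)) n = y n"
      using survivor[OF inf, of n] y
      by (cases "1 \<le> n") (auto simp: insertion_apply Omega2_def PiE_iff extensional_def)
  qed
  then show ?thesis by (simp add: recover_def m)
qed

lemma recover_in:
  assumes x: "x \<in> squarefree_flow" and full: "full_off (missed x) x"
  shows "recover x \<in> carrier GG \<times> Omega2"
proof -
  have inf: "infinite (- sieved (missed x))"
    by (rule infinite_unsieved[OF missed(2)[OF x] full])
  have "x k \<in> {0, 1}" if "1 \<le> k" for k
    using x that by (auto simp: squarefree_flow_def Omega2_def PiE_iff)
  then have "(\<lambda>n\<in>{1..}. x (survivor (missed x) n)) \<in> Omega2"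
    using survivor(1)[OF inf] unfolding Omega2_def by (intro restrict_PiE_iff[THEN iffD2]) auto
  then show ?thesis using missed(1)[OF x] by (simp add: recover_def)
qed

text \<open>
  This direction holds on the whole flow. Sieved positions carry \<open>0\<close> because they avoid the support;
  at any other position \<^const>\<open>survivor\<close> undoes \<^const>\<open>slot\<close>.
\<close>

lemma insertion_recover:
  assumes x: "x \<in> squarefree_flow"
  shows "insertion (recover x) = x"
proof
  fix k
  have xO: "x \<in> Omega2" using x by (simp add: squarefree_flow_def)
  show "insertion (recover x) k = x k"
  proof (cases "1 \<le> k")
    case False
    then show ?thesis using xO
      by (auto simp: Omega2_def PiE_iff extensional_def recover_def insertion_def)
  next
    case k: True
    have "x k = 0" if "k \<in> sieved (missed x)"
    proof -
      have "k \<notin> supp x" using missed(2)[OF x] that by auto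
      then show ?thesis using xO k by (auto simp: supp_def Omega2_def PiE_iff)
    qed
    then show ?thesis
      using k slot_pos[of k "missed x"] survivor_slot[of k "missed x"]
      by (simp add: recover_def insertion_apply)
  qed
qed


section \<open>Equivariance\<close>

lemma T1_in: "T1 g \<in> carrier GG"
  by (auto simp: GG_carrier T1_def prime_gt_0_nat)

lemma shift_in: "y \<in> Omega2 \<Longrightarrow> shift y \<in> Omega2"
  by (auto simp: Omega2_def shift_def PiE_iff)

lemma sieved_T1: "n \<in> sieved (T1 g) \<longleftrightarrow> Suc n \<in> sieved g"
proof -
  have "[int n = T1 g p] (mod int (p\<^sup>2)) \<longleftrightarrow> [int (Suc n) = g p] (mod int (p\<^sup>2))" if "prime p" for p
  proof -
    have "[int n = T1 g p] (mod int (p\<^sup>2)) \<longleftrightarrow> [int n = g p - 1] (mod int (p\<^sup>2))"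
      using that by (simp add: T1_def cong_def)
    also have "\<dots> \<longleftrightarrow> [int n + 1 = g p - 1 + 1] (mod int (p\<^sup>2))"
      by (rule cong_add_rcancel[symmetric])
    finally show ?thesis by (simp add: add.commute)
  qed
  then show ?thesis by (auto simp: sieved_def)
qed

text \<open>
  The cocycle identity behind the skew product: a step of the shift uses up a slot exactly when
  position \<open>1\<close> is not sieved.
\<close>

lemma slot_Suc: "slot g (Suc k) = slot (T1 g) k + (if 1 \<in> sieved g then 0 else 1)"
proof -
  have *: "{1..Suc k} - sieved g = ({1} - sieved g) \<union> Suc ` ({1..k} - sieved (T1 g))" (is "_ = ?A \<union> ?B")
  proof (intro equalityI subsetI)
    fix n assume n: "n \<in> {1..Suc k} - sieved g"
    then obtain j where "n = Suc j" by (cases n) auto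
    then show "n \<in> ?A \<union> ?B" using n by (cases "j = 0") (auto simp: sieved_T1)
  qed (auto simp: sieved_T1)
  have "card (?A \<union> ?B) = card ?A + card ?B"
    by (intro card_Un_disjoint) auto
  moreover have "card ?A = (if 1 \<in> sieved g then 0 else 1)"
    by (simp add: insert_Diff_if)
  ultimately show ?thesis unfolding slot_def * by (simp add: card_image)
qed

lemma insertion_skew:
  assumes g: "g \<in> carrier GG"
  shows "insertion (skew (g, y)) = shift (insertion (g, y))"
proof
  fix k
  have G1: "g \<in> G1 \<longleftrightarrow> 1 \<in> sieved g"
    using g by (auto simp: G1_def sieved_def cong_sym_eq)
  show "insertion (skew (g, y)) k = shift (insertion (g, y)) k"
  proof (cases "1 \<le> k")
    case False
    then show ?thesis by (simp add: insertion_def shift_def skew_def)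
  next
    case k: True
    show ?thesis
    proof (cases "k \<in> sieved (T1 g)")
      case True
      then show ?thesis using k by (simp add: insertion_apply shift_def skew_def sieved_T1)
    next
      case False
      then show ?thesis using k slot_pos[OF k False] slot_Suc[of g k]
        by (auto simp: insertion_apply shift_def skew_def sieved_T1 G1)
    qed
  qed
qed

lemma supp_shift: "n \<in> supp (shift x) \<longleftrightarrow> 1 \<le> n \<and> Suc n \<in> supp x"
  by (auto simp: supp_def shift_def)

lemma supp_shift_sieved: "supp x \<inter> sieved g = {} \<Longrightarrow> supp (shift x) \<inter> sieved (T1 g) = {}"
  by (auto simp: supp_shift sieved_T1)

lemma shift_in_flow:
  assumes "x \<in> squarefree_flow"
  shows "shift x \<in> squarefree_flow"
  using assms
  by (intro squarefree_flowI[OF shift_in T1_in supp_shift_sieved[OF missed(2)[OF assms]]])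
     (simp add: squarefree_flow_def)

lemma full_off_shift:
  assumes g: "g \<in> carrier GG" and full: "full_off g x"
  shows "full_off (T1 g) (shift x)"
  unfolding full_off_def
proof (intro allI impI ballI)
  fix p :: nat and r :: int and K :: nat
  assume p: "prime p" and r: "r \<in> {0..<int (p\<^sup>2)}" and ne: "r \<noteq> T1 g p"
  have p0: "int (p\<^sup>2) > 0" using p prime_gt_0_nat by auto
  \<comment> \<open>Hits of \<open>shift x\<close> in the class \<open>r\<close> are hits of \<open>x\<close> in the class \<open>r + 1\<close>, one position later.\<close>
  define s where "s = (r + 1) mod int (p\<^sup>2)"
  have "s \<noteq> g p"
  proof
    assume "s = g p"
    then have "T1 g p = ((r + 1) mod int (p\<^sup>2) - 1) mod int (p\<^sup>2)" using p by (simp add: T1_def s_def)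
    also have "\<dots> = r" using r by (simp add: mod_simps)
    finally show False using ne by simp
  qed
  moreover have "s \<in> {0..<int (p\<^sup>2)}" using p0 by (simp add: s_def)
  ultimately obtain k where k: "k > Suc K" "x k = 1" "[int k = s] (mod int (p\<^sup>2))"
    using full p unfolding full_off_def by blast
  then obtain j where j: "k = Suc j" by (cases k) auto
  have "[int j + 1 = r + 1] (mod int (p\<^sup>2))" using k(3) by (simp add: j s_def cong_def add.commute)
  then have "[int j = r] (mod int (p\<^sup>2))" by (simp only: cong_add_rcancel)
  then show "\<exists>k>K. shift x k = 1 \<and> [int k = r] (mod int (p\<^sup>2))"
    using k by (intro exI[of _ j]) (auto simp: j shift_def)
qed

section \<open>Measurability\<close>

definition group_space :: "(nat \<Rightarrow> int) measure" where
  "group_space = (\<Pi>\<^sub>M p\<in>{p. prime p}. count_space (carrier (integer_mod_group (p\<^sup>2))))"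

definition sequence_space :: "(nat \<Rightarrow> nat) measure" where
  "sequence_space = (\<Pi>\<^sub>M n\<in>{1..}. count_space {0, 1})"

lemma space_group_space: "space group_space = carrier GG"
  by (simp add: group_space_def space_PiM GG_def)

lemma space_sequence_space: "space sequence_space = Omega2"
  by (simp add: sequence_space_def space_PiM Omega2_def)

text \<open>
  Coordinates are taken with values in the full discrete type, including the constant \<open>undefined\<close>
  outside the index set. Measurability of the maps below can then be checked coordinatewise without
  side conditions on the index.
\<close>

lemma measurable_coordinate:
  "(\<lambda>f. f i) \<in> (\<Pi>\<^sub>M i\<in>I. count_space (A i)) \<rightarrow>\<^sub>M count_space UNIV"
proof (cases "i \<in> I")
  case True
  have "(\<lambda>f. f i) \<in> (\<Pi>\<^sub>M i\<in>I. count_space (A i)) \<rightarrow>\<^sub>M count_space (A i)"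
    by (rule measurable_component_singleton[OF True])
  then show ?thesis by (rule measurable_compose) simp
next
  case False
  have "f i = undefined" if "f \<in> space (\<Pi>\<^sub>M i\<in>I. count_space (A i))" for f
    using that False by (auto simp: space_PiM PiE_iff extensional_def)
  then show ?thesis
    by (subst measurable_cong[where g = "\<lambda>_. undefined"]) auto
qed

lemma measurable_into_product:
  fixes f :: "'z \<Rightarrow> 'i \<Rightarrow> 'a::countable"
  assumes f: "\<And>i. i \<in> I \<Longrightarrow> (\<lambda>z. f z i) \<in> M \<rightarrow>\<^sub>M count_space UNIV"
    and sp: "\<And>z. z \<in> space M \<Longrightarrow> f z \<in> (\<Pi>\<^sub>E i\<in>I. A i)"
  shows "f \<in> M \<rightarrow>\<^sub>M (\<Pi>\<^sub>M i\<in>I. count_space (A i))"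
proof -
  have "(\<lambda>z. f z i) \<in> M \<rightarrow>\<^sub>M count_space (A i)" if i: "i \<in> I" for i
    unfolding measurable_count_space_eq2_countable
  proof safe
    fix z assume "z \<in> space M"
    then show "f z i \<in> A i" using sp i by auto
  next
    fix a :: 'a
    have "{a} \<in> sets (count_space UNIV)" by simp
    from measurable_sets[OF f[OF i] this] show "(\<lambda>z. f z i) -` {a} \<inter> space M \<in> sets M" .
  qed
  then show ?thesis by (intro measurable_PiM_single') (use sp in auto)
qed

lemma measurable_group_coordinate: "(\<lambda>g. g p) \<in> group_space \<rightarrow>\<^sub>M count_space UNIV"
  unfolding group_space_def by (rule measurable_coordinate)

lemma measurable_sequence_coordinate: "(\<lambda>y. y n) \<in> sequence_space \<rightarrow>\<^sub>M count_space UNIV"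
  unfolding sequence_space_def by (rule measurable_coordinate)

lemma measurable_into_group_space:
  assumes "\<And>p. (\<lambda>z. f z p) \<in> M \<rightarrow>\<^sub>M count_space UNIV" "\<And>z. z \<in> space M \<Longrightarrow> f z \<in> carrier GG"
  shows "f \<in> M \<rightarrow>\<^sub>M group_space"
  unfolding group_space_def using assms
  by (intro measurable_into_product) (auto simp: GG_def)

lemma measurable_into_sequence_space:
  assumes "\<And>n. (\<lambda>z. f z n) \<in> M \<rightarrow>\<^sub>M count_space UNIV" "\<And>z. z \<in> space M \<Longrightarrow> f z \<in> Omega2"
  shows "f \<in> M \<rightarrow>\<^sub>M sequence_space"
  unfolding sequence_space_def using assms
  by (intro measurable_into_product) (auto simp: Omega2_def)

text \<open>
  The ingredients are built from coordinates by countable quantifiers, cardinalities and least elements.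
  The group element and the sequence are allowed to depend on a common parameter, so that the same facts
  apply to pairs \<open>(g, y)\<close>, and to a sequence together with the group element read off from it.
\<close>

context
  fixes M :: "'a measure" and g :: "'a \<Rightarrow> nat \<Rightarrow> int" and x :: "'a \<Rightarrow> nat \<Rightarrow> nat"
begin

lemma measurable_sieved:
  assumes [measurable]: "\<And>p. (\<lambda>z. g z p) \<in> M \<rightarrow>\<^sub>M count_space UNIV"
  shows "Measurable.pred M (\<lambda>z. k \<in> sieved (g z))"
  unfolding sieved_def mem_Collect_eq by measurable

lemma measurable_slot:
  assumes g: "\<And>p. (\<lambda>z. g z p) \<in> M \<rightarrow>\<^sub>M count_space UNIV"
  shows "(\<lambda>z. slot (g z) k) \<in> M \<rightarrow>\<^sub>M count_space UNIV"
  unfolding slot_def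
proof (rule measurable_card)
  fix i
  note measurable_sieved[OF g, measurable]
  show "{z \<in> space M. i \<in> {1..k} - sieved (g z)} \<in> sets M"
    unfolding Diff_iff by measurable
qed

lemma measurable_survivor:
  assumes g: "\<And>p. (\<lambda>z. g z p) \<in> M \<rightarrow>\<^sub>M count_space UNIV"
  shows "(\<lambda>z. survivor (g z) n) \<in> M \<rightarrow>\<^sub>M count_space UNIV"
  unfolding survivor_def
proof (rule measurable_Least)
  note measurable_sieved[OF g, measurable] measurable_slot[OF g, measurable]
  show "Measurable.pred M (\<lambda>z. 1 \<le> k \<and> k \<notin> sieved (g z) \<and> slot (g z) k = n)" for k
    by measurable
qed

lemma measurable_insertion_coordinate:
  assumes g: "\<And>p. (\<lambda>z. g z p) \<in> M \<rightarrow>\<^sub>M count_space UNIV"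
    and x: "\<And>n. (\<lambda>z. x z n) \<in> M \<rightarrow>\<^sub>M count_space UNIV"
  shows "(\<lambda>z. insertion (g z, x z) k) \<in> M \<rightarrow>\<^sub>M count_space UNIV"
proof (cases "1 \<le> k")
  case True
  note measurable_sieved[OF g, measurable]
  have [measurable]: "(\<lambda>z. x z (slot (g z) k)) \<in> M \<rightarrow>\<^sub>M count_space UNIV"
    by (rule measurable_compose_countable[OF x measurable_slot[OF g]])
  show ?thesis unfolding insertion_apply[OF True] by measurable
qed (simp add: insertion_def)

lemma measurable_full_off:
  assumes g[measurable]: "\<And>p. (\<lambda>z. g z p) \<in> M \<rightarrow>\<^sub>M count_space UNIV"
    and x[measurable]: "\<And>n. (\<lambda>z. x z n) \<in> M \<rightarrow>\<^sub>M count_space UNIV"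
  shows "Measurable.pred M (\<lambda>z. full_off (g z) (x z))"
  unfolding full_off_def by measurable

lemma measurable_missed_coordinate:
  assumes x[measurable]: "\<And>n. (\<lambda>z. x z n) \<in> M \<rightarrow>\<^sub>M count_space UNIV"
  shows "(\<lambda>z. missed (x z) p) \<in> M \<rightarrow>\<^sub>M count_space UNIV"
proof (cases "prime p")
  case True
  have "Measurable.pred M (\<lambda>z. \<forall>k\<in>supp (x z). \<not> [int k = int c] (mod int (p\<^sup>2)))" for c
    unfolding supp_def Ball_def mem_Collect_eq by measurable
  from measurable_Least[OF this]
  have [measurable]: "(\<lambda>z. LEAST c. \<forall>k\<in>supp (x z). \<not> [int k = int c] (mod int (p\<^sup>2)))
      \<in> M \<rightarrow>\<^sub>M count_space UNIV" .
  have "p \<in> {p. prime p}" using True by simp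
  then show ?thesis unfolding missed_def restrict_apply'[OF \<open>p \<in> {p. prime p}\<close>] by measurable
qed (simp add: missed_def)

end

lemma space_squarefree_space: "space squarefree_space = squarefree_flow"
  unfolding squarefree_space_def sequence_space_def[symmetric]
  by (auto simp: space_restrict_space space_sequence_space squarefree_flow_def)

lemma measurable_insertion:
  "insertion \<in> group_space \<Otimes>\<^sub>M sequence_space \<rightarrow>\<^sub>M squarefree_space"
  unfolding squarefree_space_def sequence_space_def[symmetric]
proof (rule measurable_restrict_space2)
  show "insertion \<in> space (group_space \<Otimes>\<^sub>M sequence_space) \<rightarrow> squarefree_flow"
    by (auto simp: space_pair_measure space_group_space space_sequence_space insertion_in_flow)
  show "insertion \<in> group_space \<Otimes>\<^sub>M sequence_space \<rightarrow>\<^sub>M sequence_space"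
  proof (rule measurable_into_sequence_space)
    fix n
    have "(\<lambda>z. insertion (fst z, snd z) n) \<in> group_space \<Otimes>\<^sub>M sequence_space \<rightarrow>\<^sub>M count_space UNIV"
      by (rule measurable_insertion_coordinate[where g = fst and x = snd];
          rule measurable_compose[OF measurable_fst measurable_group_coordinate]
               measurable_compose[OF measurable_snd measurable_sequence_coordinate])
    then show "(\<lambda>z. insertion z n) \<in> group_space \<Otimes>\<^sub>M sequence_space \<rightarrow>\<^sub>M count_space UNIV"
      by simp
  qed (auto simp: space_pair_measure space_sequence_space insertion_in_Omega2)
qed

lemma measurable_shift: "shift \<in> sequence_space \<rightarrow>\<^sub>M sequence_space"
proof (rule measurable_into_sequence_space)
  show "(\<lambda>y. shift y n) \<in> sequence_space \<rightarrow>\<^sub>M count_space UNIV" for n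
    by (cases "1 \<le> n") (simp_all add: shift_def measurable_sequence_coordinate)
qed (simp add: space_sequence_space shift_in)

lemma measurable_skew:
  "skew \<in> group_space \<Otimes>\<^sub>M sequence_space \<rightarrow>\<^sub>M group_space \<Otimes>\<^sub>M sequence_space"
proof -
  let ?N = "group_space \<Otimes>\<^sub>M sequence_space"
  have g[measurable]: "(\<lambda>z. fst z p) \<in> ?N \<rightarrow>\<^sub>M count_space UNIV" for p
    by (rule measurable_compose[OF measurable_fst measurable_group_coordinate])
  have [measurable]: "(\<lambda>z. T1 (fst z)) \<in> ?N \<rightarrow>\<^sub>M group_space"
  proof (rule measurable_into_group_space)
    show "(\<lambda>z. T1 (fst z) p) \<in> ?N \<rightarrow>\<^sub>M count_space UNIV" for p
      by (cases "prime p") (auto simp: T1_def)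
  qed (rule T1_in)
  have [measurable]: "Measurable.pred ?N (\<lambda>z. fst z \<in> G1)"
  proof -
    have "Measurable.pred ?N (\<lambda>z. \<exists>p::nat. prime p \<and> [fst z p = 1] (mod int (p\<^sup>2)))"
      by measurable
    moreover have "fst z \<in> G1 \<longleftrightarrow> (\<exists>p::nat. prime p \<and> [fst z p = 1] (mod int (p\<^sup>2)))"
      if "z \<in> space ?N" for z
      using that by (auto simp: G1_def space_pair_measure space_group_space)
    ultimately show ?thesis by (simp cong: measurable_cong)
  qed
  note [measurable] = measurable_compose[OF measurable_snd measurable_shift]
  have "(\<lambda>z. (T1 (fst z), if fst z \<in> G1 then snd z else shift (snd z))) \<in> ?N \<rightarrow>\<^sub>M ?N"
    by measurable
  then show ?thesis by (simp add: skew_def case_prod_unfold)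
qed

lemma measurable_recover:
  "recover \<in> restrict_space squarefree_space {x \<in> squarefree_flow. full_off (missed x) x}
     \<rightarrow>\<^sub>M group_space \<Otimes>\<^sub>M sequence_space"
proof -
  let ?R = "restrict_space squarefree_space {x \<in> squarefree_flow. full_off (missed x) x}"
  have sp: "space ?R = {x \<in> squarefree_flow. full_off (missed x) x}"
    by (auto simp: space_restrict_space space_squarefree_space)
  have x: "(\<lambda>x. x n) \<in> ?R \<rightarrow>\<^sub>M count_space UNIV" for n
    unfolding squarefree_space_def sequence_space_def[symmetric]
    by (intro measurable_restrict_space1 measurable_sequence_coordinate)
  have m: "(\<lambda>x. missed x p) \<in> ?R \<rightarrow>\<^sub>M count_space UNIV" for p
    by (rule measurable_missed_coordinate[OF x])
  have "fst \<circ> recover \<in> ?R \<rightarrow>\<^sub>M group_space"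
    using m by (intro measurable_into_group_space) (auto simp: recover_def sp missed)
  moreover have "snd \<circ> recover \<in> ?R \<rightarrow>\<^sub>M sequence_space"
  proof (rule measurable_into_sequence_space)
    fix n
    have "(\<lambda>x. x (survivor (missed x) n)) \<in> ?R \<rightarrow>\<^sub>M count_space UNIV"
      by (rule measurable_compose_countable[OF x measurable_survivor[OF m]])
    then show "(\<lambda>x. (snd \<circ> recover) x n) \<in> ?R \<rightarrow>\<^sub>M count_space UNIV"
      by (cases "1 \<le> n") (auto simp: recover_def)
  next
    fix x assume "x \<in> space ?R"
    then show "(snd \<circ> recover) x \<in> Omega2"
      using recover_in[of x] by (auto simp: sp mem_Times_iff)
  qed
  ultimately show ?thesis by (simp add: measurable_pair_iff)
qed


section \<open>The two factors\<close>

lemma sets_bernoulli_half: "sets bernoulli_half = sets sequence_space"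
  unfolding bernoulli_half_def sequence_space_def
  by (intro sets_PiM_cong) (auto simp: sets_uniform_count_measure)

lemma space_bernoulli_half: "space bernoulli_half = Omega2"
  using sets_eq_imp_space_eq[OF sets_bernoulli_half] by (simp add: space_sequence_space)

lemma prob_space_bernoulli_half: "prob_space bernoulli_half"
  unfolding bernoulli_half_def by (intro prob_space_PiM prob_space_uniform_count_measure) auto

lemma distr_shift_bernoulli_half: "distr bernoulli_half bernoulli_half shift = bernoulli_half"
  unfolding bernoulli_half_def shift_def
  by (rule distr_PiM_reindex[where f = "\<lambda>n. n + 1" and M = "\<lambda>_. uniform_count_measure {0, 1}"])
     (auto intro: prob_space_uniform_count_measure)

text \<open>
  The event that all symbols at positions in \<open>D\<close> vanish is contained, for any \<open>j\<close>, in a cylinder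
  prescribing \<open>j\<close> zeros, which has measure \<open>(1/2) ^ j\<close>.
\<close>

lemma AE_bernoulli_half_hits:
  assumes D: "infinite D" "D \<subseteq> {1..}"
  shows "AE y in bernoulli_half. \<exists>n\<in>D. y n = 1"
proof -
  interpret prob_space bernoulli_half by (rule prob_space_bernoulli_half)
  define N where "N = {y \<in> space bernoulli_half. \<not> (\<exists>n\<in>D. y n = 1)}"
  have N: "N \<in> sets bernoulli_half"
  proof -
    note [measurable] = measurable_sequence_coordinate
    have "{y \<in> space sequence_space. \<not> (\<exists>n\<in>D. y n = 1)} \<in> sets sequence_space" by measurable
    then show ?thesis
      by (simp add: N_def sets_bernoulli_half space_bernoulli_half space_sequence_space)
  qed
  have bound: "prob N \<le> (1/2) ^ j" for j
  proof -
    obtain F where F: "F \<subseteq> D" "finite F" "card F = j"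
      using infinite_arbitrarily_large[OF D(1)] by blast
    let ?u = "\<lambda>_. uniform_count_measure {0, 1::nat}"
    let ?C = "prod_emb {1..} ?u F (\<Pi>\<^sub>E n\<in>F. {0})"
    have "N \<subseteq> ?C"
    proof
      fix y assume y: "y \<in> N"
      then have yO: "y \<in> {1..} \<rightarrow>\<^sub>E {0, 1}" by (simp add: N_def space_bernoulli_half Omega2_def)
      have "y n = 0" if "n \<in> F" for n
      proof -
        have "n \<in> D" using F that by blast
        then have "y n \<in> {0, 1}" using PiE_mem[OF yO] D by blast
        moreover have "y n \<noteq> 1" using y \<open>n \<in> D\<close> unfolding N_def by blast
        ultimately show ?thesis by blast
      qed
      then have "restrict y F = (\<lambda>n\<in>F. 0)" by (intro restrict_ext)
      then show "y \<in> ?C"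
        using yO by (simp add: prod_emb_def space_uniform_count_measure)
    qed
    moreover have C: "?C \<in> sets bernoulli_half"
      unfolding bernoulli_half_def using F D
      by (intro sets_PiM_I) (auto simp: sets_uniform_count_measure)
    ultimately have "emeasure bernoulli_half N \<le> emeasure bernoulli_half ?C"
      by (rule emeasure_mono)
    also have "\<dots> = (\<Prod>n\<in>F. emeasure (?u n) {0})"
      unfolding bernoulli_half_def using F D
      by (intro emeasure_PiM_emb) (auto simp: sets_uniform_count_measure intro: prob_space_uniform_count_measure)
    also have "\<dots> = (\<Prod>n\<in>F. ennreal (1/2))"
      by (simp add: emeasure_uniform_count_measure)
    also have "\<dots> = ennreal ((1/2) ^ j)"
      by (simp only: prod_constant F(3) ennreal_power[of "1/2"])
    finally show ?thesis by (simp add: emeasure_eq_measure)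
  qed
  have "(\<lambda>j. (1/2::real) ^ j) \<longlonglongrightarrow> 0" by (rule LIMSEQ_realpow_zero) auto
  then have "prob N \<le> 0" by (rule LIMSEQ_le_const) (use bound in blast)
  then have "N \<in> null_sets bernoulli_half"
    using N by (intro null_setsI) (auto simp: emeasure_eq_measure measure_le_0_iff)
  then show ?thesis by (rule AE_I') (auto simp: N_def)
qed

text \<open>
  By the Chinese remainder theorem: at \<open>p\<close> prescribe the class \<open>r\<close>, and at every other prime \<open>q \<le> Q\<close>
  prescribe \<open>g q + 1\<close>, which differs from \<open>g q\<close> modulo \<open>q\<^sup>2\<close>.
\<close>

lemma ex_in_class_avoiding:
  fixes g :: "nat \<Rightarrow> int"
  assumes p: "prime p" and r: "0 \<le> r"
  shows "\<exists>k>K. [int k = r] (mod int (p\<^sup>2)) \<and>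
    (\<forall>q. prime q \<and> q \<le> Q \<and> q \<noteq> p \<longrightarrow> \<not> [int k = g q] (mod int (q\<^sup>2)))"
proof -
  define A where "A = insert p {q. prime q \<and> q \<le> Q}"
  define u where "u = (\<lambda>q. if q = p then nat r else nat ((g q + 1) mod int (q\<^sup>2)))"
  have A: "finite A" "\<And>q. q \<in> A \<Longrightarrow> prime q" using p by (auto simp: A_def)
  have "\<forall>i\<in>A. \<forall>j\<in>A. i \<noteq> j \<longrightarrow> coprime (i\<^sup>2) (j\<^sup>2)"
    using A(2) by (auto simp: primes_coprime)
  from chinese_remainder_nat[OF A(1) this, of u]
  obtain x where x: "\<And>q. q \<in> A \<Longrightarrow> [x = u q] (mod q\<^sup>2)" by blast
  define M where "M = (\<Prod>q\<in>A. q\<^sup>2)"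
  have "M > 0" unfolding M_def using A(2) prime_gt_0_nat by (intro prod_pos) auto
  define k where "k = x + (K + 1) * M"
  have "K + 1 \<le> (K + 1) * M" using \<open>M > 0\<close> by (intro le_trans[OF _ mult_le_mono2[of 1 M]]) auto
  then have "k > K" unfolding k_def by linarith
  have k: "[int k = int (u q)] (mod int (q\<^sup>2))" if "q \<in> A" for q
  proof -
    have "q\<^sup>2 dvd M" unfolding M_def using A(1) that by (intro dvd_prodI)
    then have "q\<^sup>2 dvd (K + 1) * M" by (rule dvd_mult)
    then have "[k = x] (mod q\<^sup>2)" unfolding k_def by (auto simp: cong_def elim!: dvdE)
    then have "[k = u q] (mod q\<^sup>2)" using x[OF that] by (rule cong_trans)
    then show ?thesis by (simp only: cong_int_iff)
  qed
  have "[int k = r] (mod int (p\<^sup>2))" using k[of p] r by (simp add: A_def u_def)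
  moreover have "\<not> [int k = g q] (mod int (q\<^sup>2))" if q: "prime q" "q \<le> Q" "q \<noteq> p" for q
  proof
    assume "[int k = g q] (mod int (q\<^sup>2))"
    have q1: "1 < int (q\<^sup>2)" using prime_gt_1_nat[OF q(1)] by (simp add: one_less_power)
    then have "int (u q) = (g q + 1) mod int (q\<^sup>2)" using q by (simp add: u_def)
    then have "[int k = g q + 1] (mod int (q\<^sup>2))" using k[of q] q by (simp add: A_def cong_def)
    then have "[g q + 1 = g q] (mod int (q\<^sup>2))"
      using \<open>[int k = g q] (mod int (q\<^sup>2))\<close> cong_sym cong_trans by blast
    then have "int (q\<^sup>2) dvd 1" by (simp add: cong_iff_dvd_diff)
    then show False using q1 zdvd_imp_le[of "int (q\<^sup>2)" 1] by linarith
  qed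
  ultimately show ?thesis using \<open>k > K\<close> by blast
qed

context
  fixes m :: "(nat \<Rightarrow> int) measure"
  assumes haar: "normalized_haar_measure GG GG_top m"
begin

lemma space_haar: "space m = carrier GG"
  using haar by (simp add: normalized_haar_measure_def)

lemma sets_haar: "sets m = sets group_space"
proof -
  have "sets group_space = sigma_sets (carrier GG) {U. openin GG_top U}"
    unfolding group_space_def GG_top_def GG_def carrier_product_group
    by (rule sets_PiM_eq_borel) (auto simp: carrier_integer_mod_group prime_gt_0_nat)
  then show ?thesis using haar by (simp add: normalized_haar_measure_def)
qed

lemma prob_space_haar: "prob_space m"
  using haar by (intro prob_spaceI) (simp add: normalized_haar_measure_def)

text \<open>
  Invariance under left cosets, in the form of preimages: the preimage of \<open>A\<close> under translation by
  \<open>h\<close> is the coset of \<open>A\<close> by the inverse of \<open>h\<close>.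
\<close>

lemma haar_translate:
  assumes h: "h \<in> carrier GG" and A: "A \<in> sets m"
  shows "emeasure m {g \<in> carrier GG. h \<otimes>\<^bsub>GG\<^esub> g \<in> A} = emeasure m A"
proof -
  interpret group GG by (simp add: GG_def)
  have AG: "A \<subseteq> carrier GG" using sets.sets_into_space[OF A] by (simp add: space_haar)
  have "{g \<in> carrier GG. h \<otimes>\<^bsub>GG\<^esub> g \<in> A} = (inv\<^bsub>GG\<^esub> h) <#\<^bsub>GG\<^esub> A"
  proof (intro equalityI subsetI)
    fix g assume "g \<in> {g \<in> carrier GG. h \<otimes>\<^bsub>GG\<^esub> g \<in> A}"
    then have g: "g \<in> carrier GG" "h \<otimes>\<^bsub>GG\<^esub> g \<in> A" by auto
    then have "g = inv\<^bsub>GG\<^esub> h \<otimes>\<^bsub>GG\<^esub> (h \<otimes>\<^bsub>GG\<^esub> g)" using h by (simp add: m_assoc[symmetric])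
    then show "g \<in> (inv\<^bsub>GG\<^esub> h) <#\<^bsub>GG\<^esub> A" using g unfolding l_coset_def by blast
  next
    fix g assume "g \<in> (inv\<^bsub>GG\<^esub> h) <#\<^bsub>GG\<^esub> A"
    then obtain a where a: "a \<in> A" "g = inv\<^bsub>GG\<^esub> h \<otimes>\<^bsub>GG\<^esub> a" by (auto simp: l_coset_def)
    then have "a \<in> carrier GG" using AG by auto
    then have "g \<in> carrier GG" "h \<otimes>\<^bsub>GG\<^esub> g = a" using a h by (simp_all add: m_assoc[symmetric])
    then show "g \<in> {g \<in> carrier GG. h \<otimes>\<^bsub>GG\<^esub> g \<in> A}" using a by simp
  qed
  then show ?thesis using haar h A by (simp add: normalized_haar_measure_def)
qed

lemma mult_GG: "h \<otimes>\<^bsub>GG\<^esub> g = (\<lambda>p\<in>{p. prime p}. (h p + g p) mod int (p\<^sup>2))"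
  by (simp add: GG_def)

lemma haar_T1:
  assumes A: "A \<in> sets m"
  shows "emeasure m (T1 -` A \<inter> space m) = emeasure m A"
proof -
  define h where "h = (\<lambda>p\<in>{p::nat. prime p}. (- 1) mod int (p\<^sup>2))"
  have h: "h \<in> carrier GG" by (auto simp: h_def GG_carrier prime_gt_0_nat)
  have "h \<otimes>\<^bsub>GG\<^esub> g = T1 g" for g
    unfolding mult_GG by (auto simp: h_def T1_def mod_simps)
  then show ?thesis
    using haar_translate[OF h A] by (simp add: space_haar vimage_def Int_def conj_commute)
qed

text \<open>
  A form of independence of the coordinate \<open>q\<close> from the others. The sets where \<open>g q\<close> equals
  \<open>\<phi> g + c\<close> modulo \<open>q\<^sup>2\<close>, for \<open>c\<close> running through the residues, partition the group. As \<open>\<phi>\<close> ignores the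
  coordinate \<open>q\<close>, translations of this coordinate carry each of these sets to any other. So the
  \<open>q\<^sup>2\<close> sets have equal measure.
\<close>

lemma haar_coordinate:
  fixes \<phi> :: "(nat \<Rightarrow> int) \<Rightarrow> int"
  assumes q: "prime q" and \<phi>: "\<phi> \<in> group_space \<rightarrow>\<^sub>M count_space UNIV"
    and inv: "\<And>g c. \<phi> (g(q := c)) = \<phi> g"
  shows "{g \<in> carrier GG. [\<phi> g = g q] (mod int (q\<^sup>2))} \<in> sets m"
    "measure m {g \<in> carrier GG. [\<phi> g = g q] (mod int (q\<^sup>2))} = 1 / real q ^ 2"
proof -
  interpret prob_space m by (rule prob_space_haar)
  define S where "S = (\<lambda>c. {g \<in> carrier GG. [\<phi> g + c = g q] (mod int (q\<^sup>2))})"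
  define C where "C = {0..<int (q\<^sup>2)}"
  have q0: "int (q\<^sup>2) > 0" using prime_gt_0_nat[OF q] by simp
  have S: "S c \<in> sets m" for c
  proof -
    have "Measurable.pred group_space (\<lambda>g. [i + c = g q] (mod int (q\<^sup>2)))" for i
      by (rule measurable_compose[OF measurable_group_coordinate]) (rule measurable_count_space)
    then have "Measurable.pred group_space (\<lambda>g. [\<phi> g + c = g q] (mod int (q\<^sup>2)))"
      by (rule measurable_compose_countable[OF _ \<phi>])
    then have "{g \<in> space group_space. [\<phi> g + c = g q] (mod int (q\<^sup>2))} \<in> sets group_space"
      by (rule pred_def[THEN iffD1])
    then show ?thesis by (simp only: S_def sets_haar space_group_space)
  qed
  have eq: "measure m (S c) = measure m (S 0)" if c: "c \<in> C" for c
  proof -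
    \<comment> \<open>Translation by \<open>c\<close> in the coordinate \<open>q\<close> alone.\<close>
    define e where "e = (\<lambda>p\<in>{p::nat. prime p}. if p = q then c else 0)"
    have e: "e \<in> carrier GG" using c by (auto simp: e_def GG_carrier C_def prime_gt_0_nat)
    have eg: "e \<otimes>\<^bsub>GG\<^esub> g = g(q := (c + g q) mod int (q\<^sup>2))" if "g \<in> carrier GG" for g
      using that q unfolding mult_GG by (auto simp: e_def GG_carrier PiE_iff extensional_def)
    have "g \<in> S 0 \<longleftrightarrow> g \<in> carrier GG \<and> e \<otimes>\<^bsub>GG\<^esub> g \<in> S c" for g
    proof (cases "g \<in> carrier GG")
      case g: True
      interpret G: group GG by (simp add: GG_def)
      have "e \<otimes>\<^bsub>GG\<^esub> g \<in> carrier GG" using e g by simp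
      then have "e \<otimes>\<^bsub>GG\<^esub> g \<in> S c \<longleftrightarrow> [\<phi> g + c = (c + g q) mod int (q\<^sup>2)] (mod int (q\<^sup>2))"
        by (simp add: S_def eg[OF g] inv)
      also have "\<dots> \<longleftrightarrow> [\<phi> g + c = g q + c] (mod int (q\<^sup>2))"
        by (simp add: cong_def add.commute)
      also have "\<dots> \<longleftrightarrow> [\<phi> g = g q] (mod int (q\<^sup>2))" by (rule cong_add_rcancel)
      finally show ?thesis using g by (simp add: S_def)
    qed (simp add: S_def)
    then have "S 0 = {g \<in> carrier GG. e \<otimes>\<^bsub>GG\<^esub> g \<in> S c}" by blast
    then show ?thesis using haar_translate[OF e S[of c]] by (simp add: measure_def)
  qed
  have "(\<Union>c\<in>C. S c) = space m"
  proof (intro equalityI subsetI)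
    fix g assume "g \<in> space m"
    then have "g \<in> S ((g q - \<phi> g) mod int (q\<^sup>2))"
      by (simp add: S_def space_haar cong_def mod_simps)
    then show "g \<in> (\<Union>c\<in>C. S c)" using q0 by (auto simp: C_def)
  qed (auto simp: S_def space_haar)
  moreover have "disjoint_family_on S C"
    unfolding disjoint_family_on_def
  proof (intro ballI impI)
    fix c d assume cd: "c \<in> C" "d \<in> C" "c \<noteq> d"
    have "c = d" if "g \<in> S c" "g \<in> S d" for g
    proof -
      have "[\<phi> g + c = \<phi> g + d] (mod int (q\<^sup>2))"
        using that cong_sym cong_trans unfolding S_def by blast
      then have "[c = d] (mod int (q\<^sup>2))" by (simp only: cong_add_lcancel)
      then show ?thesis using cd by (simp add: C_def cong_def)
    qed
    then show "S c \<inter> S d = {}" using cd by blast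
  qed
  ultimately have "prob (space m) = (\<Sum>c\<in>C. prob (S c))"
    using finite_measure_finite_Union[of C S] S by (auto simp: C_def)
  also have "\<dots> = real q ^ 2 * prob (S 0)" using eq by (simp add: C_def)
  finally have "prob (S 0) = 1 / real q ^ 2"
    using prob_space q0 by (simp add: field_simps)
  then show "measure m {g \<in> carrier GG. [\<phi> g = g q] (mod int (q\<^sup>2))} = 1 / real q ^ 2"
    by (simp add: S_def)
  show "{g \<in> carrier GG. [\<phi> g = g q] (mod int (q\<^sup>2))} \<in> sets m" using S[of 0] by (simp add: S_def)
qed

text \<open>
  If the whole class beyond \<open>K\<close> is sieved, then so is the first candidate left over by the primes up to
  \<open>Q\<close>. The prime sieving it exceeds \<open>Q\<close>: it is not one of the primes that the candidate avoids, and it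
  is not \<open>p\<close>, since the candidate lies in the class \<open>r\<close>, different from that of \<open>g p\<close>. For each
  prime \<open>q > Q\<close> this has probability \<open>1 / q\<^sup>2\<close>, and these values have arbitrarily small tails.
\<close>

lemma AE_unsieved_in_class:
  assumes p: "prime p" and r: "r \<in> {0..<int (p\<^sup>2)}"
  shows "AE g in m. r \<noteq> g p \<longrightarrow>
    (\<exists>k>K. k \<notin> sieved g \<and> [int k = r] (mod int (p\<^sup>2)))"
proof -
  interpret prob_space m by (rule prob_space_haar)
  define bad where "bad = {g \<in> space m. \<not> (r \<noteq> g p \<longrightarrow>
    (\<exists>k>K. k \<notin> sieved g \<and> [int k = r] (mod int (p\<^sup>2))))}"
  have bad: "bad \<in> sets m"
  proof -
    note [measurable] = measurable_group_coordinate measurable_sieved[OF measurable_group_coordinate]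
    have "{g \<in> space group_space. \<not> (r \<noteq> g p \<longrightarrow>
        (\<exists>k>K. k \<notin> sieved g \<and> [int k = r] (mod int (p\<^sup>2))))} \<in> sets group_space"
      by measurable
    then show ?thesis by (simp only: bad_def sets_haar space_haar space_group_space)
  qed
  define cand where "cand = (\<lambda>Q g k. k > K \<and> [int k = r] (mod int (p\<^sup>2)) \<and>
    (\<forall>q. prime q \<and> q \<le> Q \<and> q \<noteq> p \<longrightarrow> \<not> [int k = g q] (mod int (q\<^sup>2))))"
  define first where "first = (\<lambda>Q g. LEAST k. cand Q g k)"
  have first: "cand Q g (first Q g)" for Q g
    unfolding first_def
    by (rule LeastI_ex) (unfold cand_def, rule ex_in_class_avoiding[OF p], use r in simp)
  have mfirst: "(\<lambda>g. int (first Q g)) \<in> group_space \<rightarrow>\<^sub>M count_space UNIV" for Q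
  proof -
    note [measurable] = measurable_group_coordinate
    have "Measurable.pred group_space (\<lambda>g. cand Q g k)" for k
      unfolding cand_def by measurable
    then have "first Q \<in> group_space \<rightarrow>\<^sub>M count_space UNIV"
      unfolding first_def by (rule measurable_Least)
    then show ?thesis by (rule measurable_compose) simp
  qed
  define tail where "tail = (\<lambda>n. \<Sum>i. inverse (real (i + n) ^ 2))"
  have summable: "summable (\<lambda>i. inverse (real i ^ 2))"
    by (rule inverse_power_summable) simp
  have bound: "measure m bad \<le> tail (Suc Q)" for Q
  proof -
    define D where "D = (\<lambda>q. if prime q then
      {g \<in> carrier GG. [int (first Q g) = g q] (mod int (q\<^sup>2))} else {})"
    have D: "D q \<in> sets m" "measure m (D q) \<le> inverse (real q ^ 2)" if "q > Q" for q
    proof -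
      have "(g(q := c)) q' = g q'" if "q' \<le> Q" for g :: "nat \<Rightarrow> int" and c q'
        using that \<open>q > Q\<close> by simp
      then have "cand Q (g(q := c)) = cand Q g" for g c
        unfolding cand_def by (intro ext) (simp cong: conj_cong imp_cong)
      then have "int (first Q (g(q := c))) = int (first Q g)" for g c
        by (simp add: first_def)
      from haar_coordinate[OF _ mfirst this]
      show "D q \<in> sets m" "measure m (D q) \<le> inverse (real q ^ 2)"
        by (auto simp: D_def inverse_eq_divide)
    qed
    have DS: "measure m (D (i + Suc Q)) \<le> inverse (real (i + Suc Q) ^ 2)" for i
      by (rule D(2)) simp
    have "bad \<subseteq> (\<Union>i. D (i + Suc Q))"
    proof
      fix g assume g: "g \<in> bad"
      let ?k = "first Q g"
      have k: "?k > K" "[int ?k = r] (mod int (p\<^sup>2))"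
        "\<And>q. prime q \<Longrightarrow> q \<le> Q \<Longrightarrow> q \<noteq> p \<Longrightarrow> \<not> [int ?k = g q] (mod int (q\<^sup>2))"
        using first[of Q g] unfolding cand_def by blast+
      have gG: "g \<in> carrier GG" and ne: "r \<noteq> g p" and "?k \<in> sieved g"
        using g k by (auto simp: bad_def space_haar)
      then obtain q where q: "prime q" "[int ?k = g q] (mod int (q\<^sup>2))" by (auto simp: sieved_def)
      have "q \<noteq> p"
      proof
        assume "q = p"
        then have "[r = g p] (mod int (p\<^sup>2))" using q k(2) cong_sym cong_trans by blast
        moreover have "g p \<in> {0..<int (p\<^sup>2)}" using gG p by (auto simp: GG_carrier)
        ultimately show False using ne r by (simp add: cong_def)
      qed
      with k(3)[OF q(1)] q(2) have "q > Q" by (meson not_le)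
      then have "g \<in> D ((q - Suc Q) + Suc Q)" using q gG by (simp add: D_def)
      then show "g \<in> (\<Union>i. D (i + Suc Q))" by blast
    qed
    moreover have D': "range (\<lambda>i. D (i + Suc Q)) \<subseteq> sets m" using D by auto
    ultimately have "measure m bad \<le> measure m (\<Union>i. D (i + Suc Q))"
      by (intro finite_measure_mono) auto
    have sum: "summable (\<lambda>i. measure m (D (i + Suc Q)))"
      by (rule summable_comparison_test'[OF summable_ignore_initial_segment[OF summable, of "Suc Q"]])
         (simp only: real_norm_def abs_of_nonneg measure_nonneg DS)
    note \<open>measure m bad \<le> measure m (\<Union>i. D (i + Suc Q))\<close>
    also have "measure m (\<Union>i. D (i + Suc Q)) \<le> (\<Sum>i. measure m (D (i + Suc Q)))"
      by (rule finite_measure_subadditive_countably[OF D' sum])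
    also have "\<dots> \<le> tail (Suc Q)"
      unfolding tail_def
      by (rule suminf_le[OF _ sum summable_ignore_initial_segment[OF summable]]) (rule DS)
    finally show ?thesis .
  qed
  have "tail \<longlonglongrightarrow> 0" unfolding tail_def by (rule suminf_exist_split2[OF summable])
  then have "(\<lambda>Q. tail (Suc Q)) \<longlonglongrightarrow> 0" by (rule LIMSEQ_Suc)
  then have "measure m bad \<le> 0" by (rule LIMSEQ_le_const) (use bound in blast)
  then have "bad \<in> null_sets m"
    using bad by (intro null_setsI) (auto simp: emeasure_eq_measure measure_le_0_iff)
  then show ?thesis by (rule AE_I') (auto simp: bad_def)
qed

lemma sets_pair_haar: "sets (m \<Otimes>\<^sub>M bernoulli_half) = sets (group_space \<Otimes>\<^sub>M sequence_space)"
  by (intro sets_pair_measure_cong sets_haar sets_bernoulli_half)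

lemma space_pair_haar: "space (m \<Otimes>\<^sub>M bernoulli_half) = carrier GG \<times> Omega2"
  by (simp add: space_pair_measure space_haar space_bernoulli_half)

lemma sets_full_off:
  "{z \<in> space (m \<Otimes>\<^sub>M bernoulli_half). full_off (fst z) (insertion z)} \<in> sets (m \<Otimes>\<^sub>M bernoulli_half)"
proof -
  have "{z \<in> space (group_space \<Otimes>\<^sub>M sequence_space). full_off (fst z) (insertion z)}
      \<in> sets (group_space \<Otimes>\<^sub>M sequence_space)"
  proof -
    have g: "(\<lambda>z. fst z p) \<in> group_space \<Otimes>\<^sub>M sequence_space \<rightarrow>\<^sub>M count_space UNIV" for p
      by (rule measurable_compose[OF measurable_fst measurable_group_coordinate])
    have "(\<lambda>z. insertion (fst z, snd z) n) \<in> group_space \<Otimes>\<^sub>M sequence_space \<rightarrow>\<^sub>M count_space UNIV" for n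
      by (rule measurable_insertion_coordinate[where g = fst and x = snd, OF g])
         (rule measurable_compose[OF measurable_snd measurable_sequence_coordinate])
    then have [measurable]: "Measurable.pred (group_space \<Otimes>\<^sub>M sequence_space)
        (\<lambda>z. full_off (fst z) (insertion z))"
      by (intro measurable_full_off g) simp
    show ?thesis by measurable
  qed
  then show ?thesis
    by (simp only: sets_pair_haar space_pair_haar space_pair_measure[of group_space]
        space_group_space space_sequence_space)
qed

text \<open>
  For fixed \<open>g\<close> distinct unsieved positions use distinct slots, so infinitely many unsieved positions in
  a class give an infinite set of independent symbols.
\<close>

lemma AE_full_off: "AE z in m \<Otimes>\<^sub>M bernoulli_half. full_off (fst z) (insertion z)"
proof -
  interpret G: prob_space m by (rule prob_space_haar)
  interpret Y: prob_space bernoulli_half by (rule prob_space_bernoulli_half)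
  interpret pair_prob_space m bernoulli_half ..
  have full: "AE y in bernoulli_half. full_off g (insertion (g, y))"
    if g: "\<forall>p. prime p \<longrightarrow> (\<forall>r\<in>{0..<int (p\<^sup>2)}. \<forall>K. r \<noteq> g p \<longrightarrow>
      (\<exists>k>K. k \<notin> sieved g \<and> [int k = r] (mod int (p\<^sup>2))))" for g
  proof -
    have *: "AE y in bernoulli_half. \<exists>k>K. insertion (g, y) k = 1 \<and> [int k = r] (mod int (p\<^sup>2))"
      if p: "prime p" and r: "r \<in> {0..<int (p\<^sup>2)}" "r \<noteq> g p" for p r K
    proof -
      define E where "E = {k. k > K \<and> k \<notin> sieved g \<and> [int k = r] (mod int (p\<^sup>2))}"
      have "\<forall>L. \<exists>k>L. k \<in> E"
      proof
        fix L
        obtain k where "k > max K L" "k \<notin> sieved g" "[int k = r] (mod int (p\<^sup>2))"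
          using g[rule_format, OF p r(1,2), of "max K L"] by auto
        then show "\<exists>k>L. k \<in> E" by (auto simp: E_def)
      qed
      then have "infinite E" by (simp add: infinite_nat_iff_unbounded)
      moreover have "inj_on (slot g) E" by (auto simp: inj_on_def E_def dest: slot_inj)
      ultimately have "infinite (slot g ` E)" by (simp add: finite_image_iff)
      moreover have "slot g ` E \<subseteq> {1..}" using slot_pos by (force simp: E_def)
      ultimately have "AE y in bernoulli_half. \<exists>n\<in>slot g ` E. y n = 1"
        by (rule AE_bernoulli_half_hits)
      then show ?thesis
      proof eventually_elim
        case (elim y)
        then obtain k where "k \<in> E" "y (slot g k) = 1" by auto
        then show ?case by (intro exI[of _ k]) (auto simp: E_def insertion_apply)
      qed
    qed
    show ?thesis
      unfolding full_off_def
      by (intro AE_all_countable[THEN iffD2] allI AE_impI AE_ball_countable[THEN iffD2] ballI *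
          countable_finite finite_atLeastLessThan_int)
  qed
  show ?thesis
  proof (rule AE_pair_measure)
    show "{z \<in> space (m \<Otimes>\<^sub>M bernoulli_half). full_off (fst z) (insertion z)}
        \<in> sets (m \<Otimes>\<^sub>M bernoulli_half)"
      by (rule sets_full_off)
  next
    have "AE g in m. \<forall>p. prime p \<longrightarrow> (\<forall>r\<in>{0..<int (p\<^sup>2)}. \<forall>K. r \<noteq> g p \<longrightarrow>
      (\<exists>k>K. k \<notin> sieved g \<and> [int k = r] (mod int (p\<^sup>2))))"
      by (intro AE_all_countable[THEN iffD2] allI AE_impI AE_ball_countable[THEN iffD2] ballI
          countable_finite finite_atLeastLessThan_int AE_unsieved_in_class)
    then show "AE g in m. AE y in bernoulli_half. full_off (fst (g, y)) (insertion (g, y))"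
      by eventually_elim (use full in simp)
  qed
qed

end


section \<open>The isomorphism\<close>

text \<open>
  Fibrewise, the skew product is the identity or the shift, both of which preserve the Bernoulli measure;
  in the base, \<^const>\<open>T1\<close> is a translation. Slicing a set over the base combines the two.
\<close>

lemma mps_skew:
  assumes haar: "normalized_haar_measure GG GG_top m"
  shows "mps (m \<Otimes>\<^sub>M bernoulli_half) skew"
proof -
  let ?M = "m \<Otimes>\<^sub>M bernoulli_half"
  interpret G: prob_space m by (rule prob_space_haar[OF haar])
  interpret Y: prob_space bernoulli_half by (rule prob_space_bernoulli_half)
  interpret P: pair_prob_space m bernoulli_half ..
  note sets = sets_pair_haar[OF haar]
  have T: "skew \<in> ?M \<rightarrow>\<^sub>M ?M"
    using measurable_skew by (simp only: measurable_cong_sets[OF sets sets])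
  have T1: "T1 \<in> m \<rightarrow>\<^sub>M m"
  proof -
    have "(\<lambda>g. T1 g p) \<in> group_space \<rightarrow>\<^sub>M count_space UNIV" for p
    proof (cases "prime p")
      case True
      have "(\<lambda>g. (g p - 1) mod int (p\<^sup>2)) \<in> group_space \<rightarrow>\<^sub>M count_space UNIV"
        by (rule measurable_compose[OF measurable_group_coordinate]) (rule measurable_count_space)
      then show ?thesis using True by (simp add: T1_def)
    qed (simp add: T1_def)
    then have "T1 \<in> group_space \<rightarrow>\<^sub>M group_space"
      using T1_in by (rule measurable_into_group_space)
    then show ?thesis by (simp only: measurable_cong_sets[OF sets_haar[OF haar] sets_haar[OF haar]])
  qed
  have dT1: "distr m m T1 = m"
    by (rule measure_eqI) (use haar_T1[OF haar] T1 in \<open>auto simp: emeasure_distr\<close>)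
  have shift: "shift \<in> bernoulli_half \<rightarrow>\<^sub>M bernoulli_half"
    using measurable_shift by (simp only: measurable_cong_sets[OF sets_bernoulli_half sets_bernoulli_half])
  have "distr ?M ?M skew = ?M"
  proof (rule measure_eqI)
    fix C assume "C \<in> sets (distr ?M ?M skew)"
    then have C: "C \<in> sets ?M" by simp
    have slice: "Pair g -` C \<in> sets bernoulli_half" for g
      using C by (rule sets_Pair1)
    have fibre: "emeasure bernoulli_half (Pair g -` (skew -` C \<inter> space ?M)) =
        emeasure bernoulli_half (Pair (T1 g) -` C)" if g: "g \<in> space m" for g
    proof (cases "g \<in> G1")
      case True
      have "Pair (T1 g) -` C \<subseteq> space bernoulli_half"
        using slice by (rule sets.sets_into_space)
      then have "Pair g -` (skew -` C \<inter> space ?M) = Pair (T1 g) -` C"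
        using g True by (auto simp: skew_def space_pair_measure)
      then show ?thesis by simp
    next
      case False
      have "Pair g -` (skew -` C \<inter> space ?M) = shift -` (Pair (T1 g) -` C) \<inter> space bernoulli_half"
        using g False by (auto simp: skew_def space_pair_measure)
      then have "emeasure bernoulli_half (Pair g -` (skew -` C \<inter> space ?M)) =
          emeasure (distr bernoulli_half bernoulli_half shift) (Pair (T1 g) -` C)"
        using emeasure_distr[OF shift slice] by simp
      then show ?thesis by (simp only: distr_shift_bernoulli_half)
    qed
    have "emeasure (distr ?M ?M skew) C = emeasure ?M (skew -` C \<inter> space ?M)"
      by (rule emeasure_distr[OF T C])
    also have "\<dots> = (\<integral>\<^sup>+g. emeasure bernoulli_half (Pair g -` (skew -` C \<inter> space ?M)) \<partial>m)"
      by (rule Y.emeasure_pair_measure_alt[OF measurable_sets[OF T C]])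
    also have "\<dots> = (\<integral>\<^sup>+g. emeasure bernoulli_half (Pair (T1 g) -` C) \<partial>m)"
      by (rule nn_integral_cong) (rule fibre)
    also have "\<dots> = (\<integral>\<^sup>+g. emeasure bernoulli_half (Pair g -` C) \<partial>distr m m T1)"
      by (rule nn_integral_distr[symmetric, OF T1]) (simp add: dT1 Y.measurable_emeasure_Pair[OF C])
    also have "\<dots> = emeasure ?M C"
      by (simp only: dT1 Y.emeasure_pair_measure_alt[OF C])
    finally show "emeasure (distr ?M ?M skew) C = emeasure ?M C" .
  qed simp
  then show ?thesis using T P.prob_space_axioms by (simp add: mps_def)
qed

theorem theorem3p11:
  fixes m :: "(nat \<Rightarrow> int) measure"
  assumes "normalized_haar_measure GG GG_top m"
  shows "mps_isomorphism (m \<Otimes>\<^sub>M bernoulli_half) skew (eta m) shift insertion"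
proof -
  note haar = assms
  let ?M = "m \<Otimes>\<^sub>M bernoulli_half" and ?N = "eta m"
  note spM = space_pair_haar[OF haar]
  have mpsM: "mps ?M skew" by (rule mps_skew[OF haar])
  then have T: "skew \<in> ?M \<rightarrow>\<^sub>M ?M" and dT: "distr ?M ?M skew = ?M" and "prob_space ?M"
    by (simp_all add: mps_def)
  have setsN: "sets ?N = sets squarefree_space" by (simp add: eta_def)
  have spN: "space ?N = squarefree_flow"
    using sets_eq_imp_space_eq[OF setsN] by (simp add: space_squarefree_space)
  have \<iota>: "insertion \<in> ?M \<rightarrow>\<^sub>M ?N"
    using measurable_insertion by (simp only: measurable_cong_sets[OF sets_pair_haar[OF haar] setsN])
  have d\<iota>: "distr ?M ?N insertion = ?N"
    unfolding eta_def by (rule distr_cong) simp_all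
  have equi: "insertion (skew z) = shift (insertion z)" if "z \<in> space ?M" for z
    using that insertion_skew by (cases z) (auto simp: spM)
  have S: "shift \<in> ?N \<rightarrow>\<^sub>M ?N"
  proof -
    have "shift \<in> squarefree_space \<rightarrow>\<^sub>M squarefree_space"
      unfolding squarefree_space_def sequence_space_def[symmetric]
      by (rule measurable_restrict_space3[OF measurable_shift]) (use shift_in_flow in blast)
    then show ?thesis by (simp only: measurable_cong_sets[OF setsN setsN])
  qed
  have "distr ?N ?N shift = distr (distr ?M ?N insertion) ?N shift" by (simp only: d\<iota>)
  also have "\<dots> = distr ?M ?N (shift \<circ> insertion)" by (rule distr_distr[OF S \<iota>])
  also have "\<dots> = distr ?M ?N (insertion \<circ> skew)" by (rule distr_cong) (simp_all add: equi)
  also have "\<dots> = distr (distr ?M ?M skew) ?N insertion" by (rule distr_distr[OF \<iota> T, symmetric])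
  also have "\<dots> = ?N" by (simp only: dT d\<iota>)
  finally have dS: "distr ?N ?N shift = ?N" .
  have "prob_space ?N" using prob_space.prob_space_distr[OF \<open>prob_space ?M\<close> \<iota>] by (simp only: d\<iota>)
  then have mpsN: "mps ?N shift" using S dS by (simp add: mps_def)

  define A where "A = {z \<in> carrier GG \<times> Omega2. full_off (fst z) (insertion z)}"
  define B where "B = {x \<in> squarefree_flow. full_off (missed x) x}"
  have A_sets: "A \<in> sets ?M"
    using sets_full_off[OF haar] by (simp only: A_def spM)
  have B_sets: "B \<in> sets ?N"
  proof -
    have x: "(\<lambda>x. x n) \<in> squarefree_space \<rightarrow>\<^sub>M count_space UNIV" for n
      unfolding squarefree_space_def sequence_space_def[symmetric]
      by (intro measurable_restrict_space1 measurable_sequence_coordinate)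
    have "Measurable.pred squarefree_space (\<lambda>x. full_off (missed x) x)"
      by (rule measurable_full_off[OF measurable_missed_coordinate[OF x] x])
    from predE[OF this] show ?thesis by (simp only: B_def setsN space_squarefree_space)
  qed
  have missed_A: "missed (insertion (g, y)) = g" if "(g, y) \<in> A" for g y
    using that missed_unique[OF _ supp_insertion] by (auto simp: A_def)
  have \<iota>A: "insertion ` A \<subseteq> B"
    using missed_A insertion_in_flow by (auto simp: B_def A_def)
  have \<rho>\<iota>: "recover (insertion z) = z" if "z \<in> A" for z
    using that recover_insertion by (cases z) (auto simp: A_def)
  have \<iota>\<rho>: "insertion (recover x) = x" if "x \<in> B" for x
    using that insertion_recover by (auto simp: B_def)
  have \<rho>B: "recover ` B \<subseteq> A"
  proof (rule image_subsetI)
    fix x assume x: "x \<in> B"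
    then have "recover x \<in> carrier GG \<times> Omega2" using recover_in by (auto simp: B_def)
    moreover have "full_off (fst (recover x)) (insertion (recover x))"
      using x \<iota>\<rho>[OF x] by (simp add: B_def) (simp add: recover_def)
    ultimately show "recover x \<in> A" by (simp add: A_def)
  qed
  have bij: "bij_betw insertion A B"
    by (rule bij_betw_byWitness[where f' = recover]) (use \<rho>\<iota> \<iota>\<rho> \<iota>A \<rho>B in auto)

  have A_null: "emeasure ?M (space ?M - A) = 0"
  proof -
    have "AE z in ?M. z \<in> A"
      using AE_full_off[OF haar] AE_space by eventually_elim (simp add: A_def spM)
    then show ?thesis using A_sets
      by (subst (asm) AE_iff_measurable[where N = "space ?M - A"]) auto
  qed
  have B_null: "emeasure ?N (space ?N - B) = 0"
  proof -
    have BC: "space ?N - B \<in> sets ?N" using B_sets by auto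
    have "emeasure ?N (space ?N - B) = emeasure (distr ?M ?N insertion) (space ?N - B)"
      by (simp only: d\<iota>)
    also have "\<dots> = emeasure ?M (insertion -` (space ?N - B) \<inter> space ?M)"
      by (rule emeasure_distr[OF \<iota> BC])
    also have "\<dots> \<le> emeasure ?M (space ?M - A)"
      using \<iota>A A_sets by (intro emeasure_mono) auto
    finally show ?thesis using A_null by simp
  qed
  have TA: "skew ` A \<subseteq> A"
  proof (rule image_subsetI)
    fix z assume "z \<in> A"
    moreover obtain g y where z: "z = (g, y)" by (cases z)
    ultimately have g: "g \<in> carrier GG" and y: "y \<in> Omega2" and full: "full_off g (insertion (g, y))"
      by (auto simp: A_def)
    have "full_off (T1 g) (insertion (skew (g, y)))"
      using full_off_shift[OF g full] insertion_skew[OF g] by simp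
    then show "skew z \<in> A" unfolding z
      using T1_in[of g] y shift_in[OF y] by (simp add: A_def skew_def)
  qed
  have SB: "shift ` B \<subseteq> B"
  proof (rule image_subsetI)
    fix x assume "x \<in> B"
    then have x: "x \<in> squarefree_flow" and full: "full_off (missed x) x" by (auto simp: B_def)
    have full': "full_off (T1 (missed x)) (shift x)"
      by (rule full_off_shift[OF missed(1)[OF x] full])
    then have "missed (shift x) = T1 (missed x)"
      by (rule missed_unique[OF T1_in supp_shift_sieved[OF missed(2)[OF x]]])
    then show "shift x \<in> B" using full' shift_in_flow[OF x] by (simp add: B_def)
  qed
  have inv: "inv_into A insertion \<in> restrict_space ?N B \<rightarrow>\<^sub>M restrict_space ?M A"
  proof -
    have spR: "space (restrict_space ?N B) = B"
      by (auto simp: space_restrict_space spN B_def)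
    have "recover \<in> restrict_space ?N B \<rightarrow>\<^sub>M ?M"
    proof -
      have sets_R: "sets (restrict_space ?N B) = sets (restrict_space squarefree_space B)"
        by (simp only: sets_restrict_space setsN)
      then show ?thesis
        using measurable_recover[folded B_def]
        by (simp only: measurable_cong_sets[OF sets_R sets_pair_haar[OF haar]])
    qed
    then have "recover \<in> restrict_space ?N B \<rightarrow>\<^sub>M restrict_space ?M A"
      by (rule measurable_restrict_space2[rotated]) (use \<rho>B spR in auto)
    moreover have "inv_into A insertion x = recover x" if "x \<in> B" for x
      using that bij \<rho>B \<iota>\<rho> by (intro inv_into_f_eq) (auto simp: bij_betw_def)
    ultimately show ?thesis
      by (subst measurable_cong[where g = recover]) (simp_all add: spR)
  qed
  show ?thesis
    unfolding mps_isomorphism_def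
    using mpsM mpsN \<iota> d\<iota> A_sets B_sets A_null B_null TA SB bij inv equi
    by (intro conjI bexI[of _ A] bexI[of _ B]) (auto simp: A_def spM)
qed

end
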